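(* Let $V',V''$ be MV-algebras over $R$, let $f\in\mathrm{MV}_R(V',V'')$ be an MV-morphism, and let $S\in\mathrm{QME}_{V'}(R)$ be a solution of the quantum master equation in $V'$. Assume that $V'$ is a bialgebra, i.e. the standard compatibility between its multiplication and its comultiplication holds, and that $S\in P(V')\widehat\otimes\mathfrak m$, where $P(V')=\{v\in V'\mid\delta'(v)=v\otimes1+1\otimes v\}$ is the subspace of primitive elements of $V'$. Then the push-forward $f_!(S)=\log\big(\exp(f)(e^S)\big)$ satisfies $$f_!(S)=f(e^S).$$
   Context: $\Bbbk$ is a field of characteristic zero, $\otimes=\otimes_\Bbbk$, and Koszul signs are used throughout. $R$ is a complete local Noetherian commutative ring (a $\Bbbk$-algebra, in degree $0$) with residue field $\Bbbk$ and maximal ideal $\mathfrak m$. For a graded vector space $V$, $V\widehat\otimes R:=\varprojlim_n V\otimes R/V\otimes\mathfrak m^n$ and $V\widehat\otimes\mathfrak m$ is the kernel of $V\widehat\otimes R\to V$; convergence is $\mathfrak m$-adic. Maps and their $R$-linear extensions are denoted by the same symbol. An MV-algebra over $R$ is $V=(V,\mu,\delta,\Delta)$ where (i) $(V,\mu)$ is a unital graded commutative associative $\Bbbk$-algebra; (ii) $(V,\delta)$ is a conilpotent counital graded cocommutative coassociative $\Bbbk$-coalgebra; (iii) $\Delta:V\widehat\otimes R\to V\widehat\otimes R$ is a continuous degree $+1$ $R$-linear map with $\Delta^2=0$, $\Delta(1)=0$. The unit $\eta:\Bbbk\to V$ of $\mu$ is required to be a coaugmentation for $(V,\delta)$ and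 the counit $\epsilon:V\to\Bbbk$ of $\delta$ an augmentation for $(V,\mu)$. Conilpotent means: with $\bar\delta(v)=\delta(v)-v\otimes1-1\otimes v$ for $v\in\ker\epsilon$ and $\bar\delta(1)=0$, for every $v$ the iterates $\bar\delta^{[k]}(v)$ vanish for $k$ large, where $\bar\delta^{[0]}(v)=v$, $\bar\delta^{[k]}=(\bar\delta\otimes \mathrm{id}^{\otimes k-1})\bar\delta^{[k-1]}$. In general no compatibility between $\mu$ and $\delta$ is required. For MV-algebras $V',V''$, $\mathrm{Lin}_R(V',V'')$ denotes the continuous degree-$0$ $R$-linear maps $V'\widehat\otimes R\to V''\widehat\otimes R$, a commutative algebra under convolution $f\star g=\mu''(f\otimes g)\delta'$ (extended $R$-linearly) with unit $\mathsf e=\eta''\circ\epsilon'$. $\mathrm{Lin}^0_R(V',V'')$ is the ideal of those $f$ with $\mathrm{Im}(f\circ\eta')\subset V''\widehat\otimes\mathfrak m$. For $f\in\mathrm{Lin}_R^0(V',V'')$ the (pointwise $\mathfrak m$-adically convergent) series $\exp(f)=\mathsf e+f+f^2/2!+\cdots$ uses powers with respect to $\star$. An MV-morphism is an element of $\mathrm{MV}_R(V',V'')=\{f\in\mathrm{Lin}_R^0(V',V'')\mid \Delta''\circ\exp(f)=\exp(f)\circ\Delta'\}$. The quantum master equation in an MV-algebra $V$ is $\Delta e^S=0$ for a degree-$0$ element $S\in V\widehat\otimes\mathfrak m$, where $e^S$ is the exponential in the graded commutative algebra $V\widehat\otimes R$; $\mathrm{QME}_V(R)$ is its set of solutions. In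 $f_!(S)=\log(\exp(f)(e^S))$ the logarithm is the ordinary logarithm in the algebra $V''\widehat\otimes R$ (its argument lies in $1+V''\widehat\otimes\mathfrak m$). *)

theory Defs
  imports Complex_Main "HOL-Library.Poly_Mapping" "HOL-Library.Set_Algebras"
begin

section \<open>Formal linear combinations\<close>

text \<open>
  \<open>'x \<Rightarrow>\<^sub>0 'k\<close> is the free vector space on \<open>'x\<close>. Every tensor product below is a quotient of such a
  space by a subspace \<open>N\<close>, and its elements are honest cosets \<open>t +o N\<close>. Operations on quotients are
  computed on a representative chosen by \<open>rep\<close>; each of them respects the relations, so
  the choice is immaterial.
\<close>

definition fscale :: "'k::field \<Rightarrow> ('x \<Rightarrow>\<^sub>0 'k) \<Rightarrow> ('x \<Rightarrow>\<^sub>0 'k)" where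
  "fscale c t = Poly_Mapping.map ((*) c) t"

lemma lookup_fscale: "Poly_Mapping.lookup (fscale c t) x = c * Poly_Mapping.lookup t x"
  by (cases "Poly_Mapping.lookup t x = 0") (simp_all add: fscale_def Poly_Mapping.map.rep_eq when_def)

lemma vector_space_fscale: "vector_space (fscale :: 'k::field \<Rightarrow> ('x \<Rightarrow>\<^sub>0 'k) \<Rightarrow> _)"
  by unfold_locales
     (auto intro!: poly_mapping_eqI simp: lookup_fscale lookup_add algebra_simps)

abbreviation gen :: "'x \<Rightarrow> ('x \<Rightarrow>\<^sub>0 'k::field)" where
  "gen x \<equiv> Poly_Mapping.single x 1"

definition fspan :: "('x \<Rightarrow>\<^sub>0 'k::field) set \<Rightarrow> ('x \<Rightarrow>\<^sub>0 'k) set" where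
  "fspan = module.span fscale"

definition flin :: "('x \<Rightarrow> ('y \<Rightarrow>\<^sub>0 'k)) \<Rightarrow> ('x \<Rightarrow>\<^sub>0 'k) \<Rightarrow> ('y \<Rightarrow>\<^sub>0 'k::field)" where
  "flin F t = (\<Sum>x\<in>Poly_Mapping.keys t. fscale (Poly_Mapping.lookup t x) (F x))"

definition rep :: "'a set \<Rightarrow> 'a" where
  "rep A = (SOME a. a \<in> A)"


section \<open>The coefficient ring\<close>

definition is_ideal :: "'r::comm_ring_1 set \<Rightarrow> bool" where
  "is_ideal I \<longleftrightarrow> module.subspace (*) I"

definition is_maximal_ideal :: "'r::comm_ring_1 set \<Rightarrow> bool" where
  "is_maximal_ideal M \<longleftrightarrow> is_ideal M \<and> M \<noteq> UNIV \<and>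
     (\<forall>I. is_ideal I \<longrightarrow> M \<subseteq> I \<longrightarrow> I = M \<or> I = UNIV)"

definition max_ideal :: "'r::comm_ring_1 set" where
  "max_ideal = (THE M. is_maximal_ideal M)"

fun max_ideal_pow :: "nat \<Rightarrow> 'r::comm_ring_1 set" where
  "max_ideal_pow 0 = UNIV"
| "max_ideal_pow (Suc n) = module.span (*) {a * b | a b. a \<in> max_ideal \<and> b \<in> max_ideal_pow n}"

text \<open>
  \<open>\<iota> : \<k> \<rightarrow> R\<close> is the structure map of the \<open>\<k>\<close>-algebra \<open>R\<close>. That the residue field is \<open>\<k>\<close> means
  that \<open>\<k> \<rightarrow> R \<rightarrow> R/\<mm>\<close> is bijective; completeness means that \<open>R \<rightarrow> lim R/\<mm>\<^sup>n\<close> is injective and surjective.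
\<close>

definition complete_local_noetherian_algebra :: "('k::field \<Rightarrow> 'r::comm_ring_1) \<Rightarrow> bool" where
  "complete_local_noetherian_algebra \<iota> \<longleftrightarrow>
     \<iota> 1 = 1 \<and> (\<forall>a b. \<iota> (a + b) = \<iota> a + \<iota> b) \<and> (\<forall>a b. \<iota> (a * b) = \<iota> a * \<iota> b) \<and>
     (\<exists>!M :: 'r set. is_maximal_ideal M) \<and>
     (\<forall>I :: 'r set. is_ideal I \<longrightarrow> (\<exists>F. finite F \<and> I = module.span (*) F)) \<and>
     (\<forall>r. \<exists>!c. r - \<iota> c \<in> max_ideal) \<and>
     (\<Inter>n. max_ideal_pow n :: 'r set) = {0} \<and>
     (\<forall>a :: nat \<Rightarrow> 'r. (\<forall>n. a (Suc n) - a n \<in> max_ideal_pow n) \<longrightarrow>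
        (\<exists>r. \<forall>n. r - a n \<in> max_ideal_pow n))"

definition residue :: "('k::field \<Rightarrow> 'r::comm_ring_1) \<Rightarrow> 'r \<Rightarrow> 'k" where
  "residue \<iota> r = (THE c. r - \<iota> c \<in> max_ideal)"


section \<open>Graded vector spaces and tensor powers\<close>

text \<open>
  The underlying vector space of a structure \<open>V\<close> is the whole type \<open>'v\<close> with scalar
  multiplication \<open>vscale V\<close>. The comultiplication takes values in cosets of formal combinations of
  lists of length two; the field \<open>BV\<close> is the operator \<open>\<Delta>\<close> on
  the completed tensor product with \<open>R\<close>, whose elements are sequences of cosets.
\<close>

record (overloaded) ('k, 'v) alg_coalg =
  vscale :: "'k \<Rightarrow> 'v \<Rightarrow> 'v"
  grading :: "int \<Rightarrow> 'v set"
  mul :: "'v \<Rightarrow> 'v \<Rightarrow> 'v"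
  unit :: "'v"
  comul :: "'v \<Rightarrow> ('v list \<Rightarrow>\<^sub>0 'k) set"
  counit :: "'v \<Rightarrow> 'k"

type_synonym ('k, 'v, 'r) ctens = "nat \<Rightarrow> ('v \<times> 'r \<Rightarrow>\<^sub>0 'k) set"

record (overloaded) ('k, 'v, 'r) mv_struct = "('k, 'v) alg_coalg" +
  BV :: "('k, 'v, 'r) ctens \<Rightarrow> ('k, 'v, 'r) ctens"

definition is_decomp :: "('k::field, 'v::ab_group_add, 'z) alg_coalg_scheme \<Rightarrow> 'v \<Rightarrow> (int \<Rightarrow> 'v) \<Rightarrow> bool" where
  "is_decomp V v c \<longleftrightarrow> (\<forall>i. c i \<in> grading V i) \<and> finite {i. c i \<noteq> 0} \<and> v = (\<Sum>i | c i \<noteq> 0. c i)"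

definition graded_space :: "('k::field, 'v::ab_group_add, 'z) alg_coalg_scheme \<Rightarrow> bool" where
  "graded_space V \<longleftrightarrow> vector_space (vscale V) \<and>
     (\<forall>i. module.subspace (vscale V) (grading V i)) \<and> (\<forall>v. \<exists>!c. is_decomp V v c)"

definition hcomp :: "('k::field, 'v::ab_group_add, 'z) alg_coalg_scheme \<Rightarrow> 'v \<Rightarrow> int \<Rightarrow> 'v" where
  "hcomp V v = (THE c. is_decomp V v c)"

definition hsupp :: "('k::field, 'v::ab_group_add, 'z) alg_coalg_scheme \<Rightarrow> 'v \<Rightarrow> int set" where
  "hsupp V v = {i. hcomp V v i \<noteq> 0}"

definition ksign :: "int \<Rightarrow> int \<Rightarrow> 'k::field" where
  "ksign p q = (if odd p \<and> odd q then - 1 else 1)"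

text \<open>
  The quotient of the free vector space on all lists by \<open>multilin_rel V\<close> is the tensor
  algebra of \<open>V\<close>; lists of length \<open>n\<close> span its summand \<open>V\<^sup>\<otimes>\<^sup>n\<close>, with \<open>\<k>\<close> in length \<open>0\<close>.
\<close>

definition multilin_rel :: "('k::field, 'v::ab_group_add, 'z) alg_coalg_scheme \<Rightarrow> ('v list \<Rightarrow>\<^sub>0 'k) set" where
  "multilin_rel V = fspan
     ({gen (xs @ (u + v) # ys) - gen (xs @ u # ys) - gen (xs @ v # ys) | xs u v ys. True} \<union>
      {gen (xs @ vscale V c v # ys) - fscale c (gen (xs @ v # ys)) | xs c v ys. True})"

definition tensor_power :: "('k::field, 'v::ab_group_add, 'z) alg_coalg_scheme \<Rightarrow> nat \<Rightarrow> ('v list \<Rightarrow>\<^sub>0 'k) set set" where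
  "tensor_power V n = {t +o multilin_rel V | t. \<forall>xs\<in>Poly_Mapping.keys t. length xs = n}"

definition teq :: "('k::field, 'v::ab_group_add, 'z) alg_coalg_scheme \<Rightarrow> ('v list \<Rightarrow>\<^sub>0 'k) \<Rightarrow> ('v list \<Rightarrow>\<^sub>0 'k) \<Rightarrow> bool" where
  "teq V s t \<longleftrightarrow> s - t \<in> multilin_rel V"

text \<open>\<open>apply_at F i\<close> is \<open>id\<^sup>\<otimes>\<^sup>i \<otimes> F \<otimes> id \<otimes> \<dots> \<otimes> id\<close> for a degree-0 map \<open>F\<close> into tensors (no Koszul signs).\<close>

definition apply_at :: "('v \<Rightarrow> ('v list \<Rightarrow>\<^sub>0 'k)) \<Rightarrow> nat \<Rightarrow> ('v list \<Rightarrow>\<^sub>0 'k) \<Rightarrow> ('v list \<Rightarrow>\<^sub>0 'k::field)" where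
  "apply_at F i = flin (\<lambda>xs. if i < length xs
     then flin (\<lambda>zs. gen (take i xs @ zs @ drop (Suc i) xs)) (F (xs ! i)) else 0)"

definition kswap :: "('k::field, 'v::ab_group_add, 'z) alg_coalg_scheme \<Rightarrow> ('v list \<Rightarrow>\<^sub>0 'k) \<Rightarrow> ('v list \<Rightarrow>\<^sub>0 'k)" where
  "kswap V = flin (\<lambda>xs. case xs of
       [a, b] \<Rightarrow> (\<Sum>p\<in>hsupp V a. \<Sum>q\<in>hsupp V b. fscale (ksign p q) (gen [hcomp V b q, hcomp V a p]))
     | _ \<Rightarrow> 0)"

text \<open>The product \<open>(a \<otimes> b)(c \<otimes> d) = (-1)\<^bsup>|b||c|\<^esup> ac \<otimes> bd\<close> of \<open>V \<otimes> V\<close>.\<close>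

definition tmul2 :: "('k::field, 'v::ab_group_add, 'z) alg_coalg_scheme \<Rightarrow>
    ('v list \<Rightarrow>\<^sub>0 'k) \<Rightarrow> ('v list \<Rightarrow>\<^sub>0 'k) \<Rightarrow> ('v list \<Rightarrow>\<^sub>0 'k)" where
  "tmul2 V s t = flin (\<lambda>xs. flin (\<lambda>ys. case (xs, ys) of
       ([a, b], [c, d]) \<Rightarrow> (\<Sum>p\<in>hsupp V b. \<Sum>q\<in>hsupp V c.
          fscale (ksign p q) (gen [mul V a (hcomp V c q), mul V (hcomp V b p) d]))
     | _ \<Rightarrow> 0) t) s"


section \<open>Algebras and coalgebras\<close>

definition graded_comm_algebra :: "('k::field, 'v::ab_group_add, 'z) alg_coalg_scheme \<Rightarrow> bool" where
  "graded_comm_algebra V \<longleftrightarrow> graded_space V \<and>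
     (\<forall>a. Vector_Spaces.linear (vscale V) (vscale V) (mul V a)) \<and>
     (\<forall>b. Vector_Spaces.linear (vscale V) (vscale V) (\<lambda>a. mul V a b)) \<and>
     (\<forall>a b c. mul V (mul V a b) c = mul V a (mul V b c)) \<and>
     (\<forall>a. mul V (unit V) a = a \<and> mul V a (unit V) = a) \<and>
     unit V \<in> grading V 0 \<and>
     (\<forall>p q. \<forall>a\<in>grading V p. \<forall>b\<in>grading V q.
        mul V a b \<in> grading V (p + q) \<and> mul V a b = vscale V (ksign p q) (mul V b a))"

definition graded_cocomm_coalgebra :: "('k::field, 'v::ab_group_add, 'z) alg_coalg_scheme \<Rightarrow> bool" where
  "graded_cocomm_coalgebra V \<longleftrightarrow> graded_space V \<and>
     (\<forall>v. comul V v \<in> tensor_power V 2) \<and>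
     (\<forall>u v. comul V (u + v) = comul V u + comul V v) \<and>
     (\<forall>c v. comul V (vscale V c v) = fscale c (rep (comul V v)) +o multilin_rel V) \<and>
     (\<forall>i. \<forall>v\<in>grading V i. \<exists>t\<in>comul V v. \<forall>xs\<in>Poly_Mapping.keys t.
        \<exists>a b p q. xs = [a, b] \<and> a \<in> grading V p \<and> b \<in> grading V q \<and> p + q = i) \<and>
     Vector_Spaces.linear (vscale V) (*) (counit V) \<and>
     (\<forall>i. \<forall>v\<in>grading V i. i \<noteq> 0 \<longrightarrow> counit V v = 0) \<and>
     (let \<delta> = (\<lambda>v. rep (comul V v)); \<epsilon> = (\<lambda>v. fscale (counit V v) (gen [])) in
       (\<forall>v. teq V (apply_at \<delta> 0 (\<delta> v)) (apply_at \<delta> 1 (\<delta> v))) \<and>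
       (\<forall>v. teq V (apply_at \<epsilon> 0 (\<delta> v)) (gen [v]) \<and> teq V (apply_at \<epsilon> 1 (\<delta> v)) (gen [v])) \<and>
       (\<forall>v. teq V (kswap V (\<delta> v)) (\<delta> v)))"

text \<open>
  \<open>\<delta>\<close>-bar is given on \<open>ker \<epsilon>\<close> and vanishes on the unit; \<open>v - \<epsilon>(v)1\<close> is the component of \<open>v\<close> in \<open>ker \<epsilon>\<close>.
\<close>

definition reduced_comul :: "('k::field, 'v::ab_group_add, 'z) alg_coalg_scheme \<Rightarrow> 'v \<Rightarrow> ('v list \<Rightarrow>\<^sub>0 'k)" where
  "reduced_comul V v = (let w = v - vscale V (counit V v) (unit V) in
     rep (comul V w) - gen [w, unit V] - gen [unit V, w])"

fun reduced_comul_iter :: "('k::field, 'v::ab_group_add, 'z) alg_coalg_scheme \<Rightarrow> nat \<Rightarrow> 'v \<Rightarrow> ('v list \<Rightarrow>\<^sub>0 'k)" where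
  "reduced_comul_iter V 0 v = gen [v]"
| "reduced_comul_iter V (Suc k) v = apply_at (reduced_comul V) 0 (reduced_comul_iter V k v)"

definition conilpotent :: "('k::field, 'v::ab_group_add, 'z) alg_coalg_scheme \<Rightarrow> bool" where
  "conilpotent V \<longleftrightarrow> (\<forall>v. \<exists>K. \<forall>k\<ge>K. teq V (reduced_comul_iter V k v) 0)"

definition primitives :: "('k::field, 'v::ab_group_add, 'z) alg_coalg_scheme \<Rightarrow> 'v set" where
  "primitives V = {v. comul V v = (gen [v, unit V] + gen [unit V, v]) +o multilin_rel V}"

text \<open>
  The part of the bialgebra axioms that relates \<open>\<mu>\<close> and \<open>\<delta>\<close>; the compatibilities that involve the unit or
  the counit belong to every MV-algebra (see \<open>MV_algebra\<close> below).
\<close>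

definition bialgebra_compatible :: "('k::field, 'v::ab_group_add, 'z) alg_coalg_scheme \<Rightarrow> bool" where
  "bialgebra_compatible V \<longleftrightarrow>
     (\<forall>a b. teq V (rep (comul V (mul V a b))) (tmul2 V (rep (comul V a)) (rep (comul V b))))"


section \<open>The completed tensor product with the coefficient ring\<close>

definition tensor_rel :: "('k::field \<Rightarrow> 'r::comm_ring_1) \<Rightarrow> ('k, 'v::ab_group_add, 'z) alg_coalg_scheme \<Rightarrow> ('v \<times> 'r \<Rightarrow>\<^sub>0 'k) set" where
  "tensor_rel \<iota> V = fspan
     ({gen (u + v, r) - gen (u, r) - gen (v, r) | u v r. True} \<union>
      {gen (v, r + s) - gen (v, r) - gen (v, s) | v r s. True} \<union>
      {gen (vscale V c v, r) - fscale c (gen (v, r)) | c v r. True} \<union>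
      {gen (v, \<iota> c * r) - fscale c (gen (v, r)) | c v r. True})"

text \<open>
  \<open>V \<otimes> R / V \<otimes> \<mm>\<^sup>n\<close> as a single quotient of the free vector space on \<open>V \<times> R\<close>.
\<close>

definition adic :: "('k::field \<Rightarrow> 'r::comm_ring_1) \<Rightarrow> ('k, 'v::ab_group_add, 'z) alg_coalg_scheme \<Rightarrow> nat \<Rightarrow> ('v \<times> 'r \<Rightarrow>\<^sub>0 'k) set" where
  "adic \<iota> V n = fspan (tensor_rel \<iota> V \<union> {gen (v, r) | v r. r \<in> max_ideal_pow n})"

text \<open>
  For a subspace \<open>P\<close> of \<open>V\<close>, \<open>csub \<iota> V P\<close> is the completed tensor product of \<open>P\<close> and \<open>R\<close>, as a subset
  of the completed tensor product of \<open>V\<close> and \<open>R\<close>. An element of the inverse limit is a sequence of cosets \<open>x n\<close> such that \<open>x (n + 1)\<close> maps to \<open>x n\<close>, i.e. is contained in it.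
\<close>

definition csub :: "('k::field \<Rightarrow> 'r::comm_ring_1) \<Rightarrow> ('k, 'v::ab_group_add, 'z) alg_coalg_scheme \<Rightarrow> 'v set \<Rightarrow> ('k, 'v, 'r) ctens set" where
  "csub \<iota> V P = {x. (\<forall>n. \<exists>a. Poly_Mapping.keys a \<subseteq> P \<times> UNIV \<and> x n = a +o adic \<iota> V n) \<and>
                    (\<forall>n. x (Suc n) \<subseteq> x n)}"

definition ctensor :: "('k::field \<Rightarrow> 'r::comm_ring_1) \<Rightarrow> ('k, 'v::ab_group_add, 'z) alg_coalg_scheme \<Rightarrow> ('k, 'v, 'r) ctens set" where
  "ctensor \<iota> V = csub \<iota> V UNIV"

text \<open>
  The map to \<open>V\<close> induced by \<open>R \<rightarrow> R/\<mm> = \<k>\<close>; it factors through \<open>V \<otimes> R / V \<otimes> \<mm>\<close>. Its kernel is the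
  completed tensor product with \<open>\<mm>\<close>.
\<close>

definition reduction :: "('k::field \<Rightarrow> 'r::comm_ring_1) \<Rightarrow> ('k, 'v::ab_group_add, 'z) alg_coalg_scheme \<Rightarrow> ('k, 'v, 'r) ctens \<Rightarrow> 'v" where
  "reduction \<iota> V x = (\<Sum>(v, r)\<in>Poly_Mapping.keys (rep (x 1)).
     vscale V (Poly_Mapping.lookup (rep (x 1)) (v, r) * residue \<iota> r) v)"

definition csub_m :: "('k::field \<Rightarrow> 'r::comm_ring_1) \<Rightarrow> ('k, 'v::ab_group_add, 'z) alg_coalg_scheme \<Rightarrow> 'v set \<Rightarrow> ('k, 'v, 'r) ctens set" where
  "csub_m \<iota> V P = {x \<in> csub \<iota> V P. reduction \<iota> V x = 0}"

definition ctensor_m :: "('k::field \<Rightarrow> 'r::comm_ring_1) \<Rightarrow> ('k, 'v::ab_group_add, 'z) alg_coalg_scheme \<Rightarrow> ('k, 'v, 'r) ctens set" where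
  "ctensor_m \<iota> V = csub_m \<iota> V UNIV"

definition cpure :: "('k::field \<Rightarrow> 'r::comm_ring_1) \<Rightarrow> ('k, 'v::ab_group_add, 'z) alg_coalg_scheme \<Rightarrow> 'v \<Rightarrow> 'r \<Rightarrow> ('k, 'v, 'r) ctens" where
  "cpure \<iota> V v r = (\<lambda>n. gen (v, r) +o adic \<iota> V n)"

definition czero :: "('k::field \<Rightarrow> 'r::comm_ring_1) \<Rightarrow> ('k, 'v::ab_group_add, 'z) alg_coalg_scheme \<Rightarrow> ('k, 'v, 'r) ctens" where
  "czero \<iota> V = (\<lambda>n. adic \<iota> V n)"

definition cone :: "('k::field \<Rightarrow> 'r::comm_ring_1) \<Rightarrow> ('k, 'v::ab_group_add, 'z) alg_coalg_scheme \<Rightarrow> ('k, 'v, 'r) ctens" where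
  "cone \<iota> V = cpure \<iota> V (unit V) 1"

definition cadd :: "('k::field, 'v, 'r) ctens \<Rightarrow> ('k, 'v, 'r) ctens \<Rightarrow> ('k, 'v, 'r) ctens" where
  "cadd x y = (\<lambda>n. x n + y n)"

definition rmul :: "'r::comm_ring_1 \<Rightarrow> ('v \<times> 'r \<Rightarrow>\<^sub>0 'k) \<Rightarrow> ('v \<times> 'r \<Rightarrow>\<^sub>0 'k::field)" where
  "rmul r = flin (\<lambda>(v, s). gen (v, r * s))"

definition cscale :: "('k::field \<Rightarrow> 'r::comm_ring_1) \<Rightarrow> ('k, 'v::ab_group_add, 'z) alg_coalg_scheme \<Rightarrow>
    'r \<Rightarrow> ('k, 'v, 'r) ctens \<Rightarrow> ('k, 'v, 'r) ctens" where
  "cscale \<iota> V r x = (\<lambda>n. rmul r (rep (x n)) +o adic \<iota> V n)"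

text \<open>The product \<open>(v \<otimes> r)(w \<otimes> s) = vw \<otimes> rs\<close>; there is no sign as \<open>R\<close> has degree \<open>0\<close>.\<close>

definition fmul :: "('k::field, 'v::ab_group_add, 'z) alg_coalg_scheme \<Rightarrow>
    ('v \<times> 'r::comm_ring_1 \<Rightarrow>\<^sub>0 'k) \<Rightarrow> ('v \<times> 'r \<Rightarrow>\<^sub>0 'k) \<Rightarrow> ('v \<times> 'r \<Rightarrow>\<^sub>0 'k)" where
  "fmul V a b = flin (\<lambda>(v, r). flin (\<lambda>(w, s). gen (mul V v w, r * s)) b) a"

definition cmul :: "('k::field \<Rightarrow> 'r::comm_ring_1) \<Rightarrow> ('k, 'v::ab_group_add, 'z) alg_coalg_scheme \<Rightarrow>
    ('k, 'v, 'r) ctens \<Rightarrow> ('k, 'v, 'r) ctens \<Rightarrow> ('k, 'v, 'r) ctens" where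
  "cmul \<iota> V x y = (\<lambda>n. fmul V (rep (x n)) (rep (y n)) +o adic \<iota> V n)"

fun cpow :: "('k::field \<Rightarrow> 'r::comm_ring_1) \<Rightarrow> ('k, 'v::ab_group_add, 'z) alg_coalg_scheme \<Rightarrow>
    ('k, 'v, 'r) ctens \<Rightarrow> nat \<Rightarrow> ('k, 'v, 'r) ctens" where
  "cpow \<iota> V x 0 = cone \<iota> V"
| "cpow \<iota> V x (Suc n) = cmul \<iota> V x (cpow \<iota> V x n)"

fun csum :: "('k::field \<Rightarrow> 'r::comm_ring_1) \<Rightarrow> ('k, 'v::ab_group_add, 'z) alg_coalg_scheme \<Rightarrow>
    (nat \<Rightarrow> ('k, 'v, 'r) ctens) \<Rightarrow> nat \<Rightarrow> ('k, 'v, 'r) ctens" where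
  "csum \<iota> V X 0 = czero \<iota> V"
| "csum \<iota> V X (Suc n) = cadd (csum \<iota> V X n) (X n)"

text \<open>Adic convergence: for every \<open>n\<close> the images in \<open>V \<otimes> R / V \<otimes> \<mm>\<^sup>n\<close> are eventually constant.\<close>

definition cconverges :: "(nat \<Rightarrow> ('k::field, 'v, 'r) ctens) \<Rightarrow> ('k, 'v, 'r) ctens \<Rightarrow> bool" where
  "cconverges X x \<longleftrightarrow> (\<forall>n. \<exists>N. \<forall>k\<ge>N. X k n = x n)"

definition cseries :: "('k::field \<Rightarrow> 'r::comm_ring_1) \<Rightarrow> ('k, 'v::ab_group_add, 'z) alg_coalg_scheme \<Rightarrow>
    (nat \<Rightarrow> ('k, 'v, 'r) ctens) \<Rightarrow> ('k, 'v, 'r) ctens" where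
  "cseries \<iota> V X = (THE x. x \<in> ctensor \<iota> V \<and> cconverges (csum \<iota> V X) x)"

definition cexp :: "('k::field_char_0 \<Rightarrow> 'r::comm_ring_1) \<Rightarrow> ('k, 'v::ab_group_add, 'z) alg_coalg_scheme \<Rightarrow>
    ('k, 'v, 'r) ctens \<Rightarrow> ('k, 'v, 'r) ctens" where
  "cexp \<iota> V x = cseries \<iota> V (\<lambda>n. cscale \<iota> V (\<iota> (1 / fact n)) (cpow \<iota> V x n))"

definition clog :: "('k::field_char_0 \<Rightarrow> 'r::comm_ring_1) \<Rightarrow> ('k, 'v::ab_group_add, 'z) alg_coalg_scheme \<Rightarrow>
    ('k, 'v, 'r) ctens \<Rightarrow> ('k, 'v, 'r) ctens" where
  "clog \<iota> V x = (let y = cadd x (cscale \<iota> V (- 1) (cone \<iota> V)) in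
     cseries \<iota> V (\<lambda>n. cscale \<iota> V (\<iota> ((- 1) ^ n / of_nat (Suc n))) (cpow \<iota> V y (Suc n))))"


section \<open>Continuous linear maps and MV-algebras\<close>

text \<open>
  Maps between completed tensor products are total HOL functions of which only the values on
  \<open>ctensor \<iota> V\<close> matter.
\<close>

definition cont_lin_deg :: "('k::field \<Rightarrow> 'r::comm_ring_1) \<Rightarrow>
    ('k, 'v::ab_group_add, 'y) alg_coalg_scheme \<Rightarrow> ('k, 'w::ab_group_add, 'z) alg_coalg_scheme \<Rightarrow> int \<Rightarrow>
    (('k, 'v, 'r) ctens \<Rightarrow> ('k, 'w, 'r) ctens) set" where
  "cont_lin_deg \<iota> V W d = {f.
     (\<forall>x\<in>ctensor \<iota> V. f x \<in> ctensor \<iota> W) \<and>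
     (\<forall>x\<in>ctensor \<iota> V. \<forall>y\<in>ctensor \<iota> V. f (cadd x y) = cadd (f x) (f y)) \<and>
     (\<forall>r. \<forall>x\<in>ctensor \<iota> V. f (cscale \<iota> V r x) = cscale \<iota> W r (f x)) \<and>
     (\<forall>n. \<exists>m. \<forall>x\<in>ctensor \<iota> V. \<forall>y\<in>ctensor \<iota> V. x m = y m \<longrightarrow> f x n = f y n) \<and>
     (\<forall>i. \<forall>x\<in>csub \<iota> V (grading V i). f x \<in> csub \<iota> W (grading W (i + d)))}"

definition MV_algebra :: "('k::field_char_0 \<Rightarrow> 'r::comm_ring_1) \<Rightarrow> ('k, 'v::ab_group_add, 'r) mv_struct \<Rightarrow> bool" where
  "MV_algebra \<iota> V \<longleftrightarrow>
     graded_comm_algebra V \<and> graded_cocomm_coalgebra V \<and> conilpotent V \<and>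
     comul V (unit V) = gen [unit V, unit V] +o multilin_rel V \<and> counit V (unit V) = 1 \<and>
     (\<forall>a b. counit V (mul V a b) = counit V a * counit V b) \<and>
     BV V \<in> cont_lin_deg \<iota> V V 1 \<and>
     (\<forall>x\<in>ctensor \<iota> V. BV V (BV V x) = czero \<iota> V) \<and>
     BV V (cone \<iota> V) = czero \<iota> V"

definition Lin :: "('k::field_char_0 \<Rightarrow> 'r::comm_ring_1) \<Rightarrow> ('k, 'v::ab_group_add, 'r) mv_struct \<Rightarrow>
    ('k, 'w::ab_group_add, 'r) mv_struct \<Rightarrow> (('k, 'v, 'r) ctens \<Rightarrow> ('k, 'w, 'r) ctens) set" where
  "Lin \<iota> V W = cont_lin_deg \<iota> V W 0"

definition Lin0 :: "('k::field_char_0 \<Rightarrow> 'r::comm_ring_1) \<Rightarrow> ('k, 'v::ab_group_add, 'r) mv_struct \<Rightarrow>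
    ('k, 'w::ab_group_add, 'r) mv_struct \<Rightarrow> (('k, 'v, 'r) ctens \<Rightarrow> ('k, 'w, 'r) ctens) set" where
  "Lin0 \<iota> V W = {f \<in> Lin \<iota> V W. \<forall>c. f (cpure \<iota> V (vscale V c (unit V)) 1) \<in> ctensor_m \<iota> W}"

text \<open>
  The continuous \<open>R\<close>-linear extension \<open>v \<otimes> r \<mapsto> r \<phi>(v)\<close> of a linear map \<open>\<phi> : V \<rightarrow> ctensor \<iota> W\<close>. It maps
  \<open>V \<otimes> \<mm>\<^sup>n\<close> to zero in \<open>W \<otimes> R / W \<otimes> \<mm>\<^sup>n\<close>, so it can be computed separately for each \<open>n\<close>.
\<close>

definition cext :: "('k::field \<Rightarrow> 'r::comm_ring_1) \<Rightarrow> ('k, 'w::ab_group_add, 'z) alg_coalg_scheme \<Rightarrow>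
    ('v \<Rightarrow> ('k, 'w, 'r) ctens) \<Rightarrow> ('k, 'v, 'r) ctens \<Rightarrow> ('k, 'w, 'r) ctens" where
  "cext \<iota> W \<phi> x = (\<lambda>n. flin (\<lambda>(v, r). rmul r (rep (\<phi> v n))) (rep (x n)) +o adic \<iota> W n)"

text \<open>
  On \<open>V\<close> the convolution sends \<open>v\<close> to the sum of the products \<open>f(a) g(b)\<close> over a representative of \<open>\<delta>(v)\<close>;
  lists of length other than two contribute nothing to the class of such a representative.
\<close>

definition conv :: "('k::field_char_0 \<Rightarrow> 'r::comm_ring_1) \<Rightarrow> ('k, 'v::ab_group_add, 'r) mv_struct \<Rightarrow>
    ('k, 'w::ab_group_add, 'r) mv_struct \<Rightarrow> (('k, 'v, 'r) ctens \<Rightarrow> ('k, 'w, 'r) ctens) \<Rightarrow>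
    (('k, 'v, 'r) ctens \<Rightarrow> ('k, 'w, 'r) ctens) \<Rightarrow> (('k, 'v, 'r) ctens \<Rightarrow> ('k, 'w, 'r) ctens)" where
  "conv \<iota> V W f g = cext \<iota> W (\<lambda>v n.
     flin (\<lambda>xs. case xs of
         [a, b] \<Rightarrow> rep (cmul \<iota> W (f (cpure \<iota> V a 1)) (g (cpure \<iota> V b 1)) n)
       | _ \<Rightarrow> 0) (rep (comul V v)) +o adic \<iota> W n)"

definition conv_unit :: "('k::field_char_0 \<Rightarrow> 'r::comm_ring_1) \<Rightarrow> ('k, 'v::ab_group_add, 'r) mv_struct \<Rightarrow>
    ('k, 'w::ab_group_add, 'r) mv_struct \<Rightarrow> (('k, 'v, 'r) ctens \<Rightarrow> ('k, 'w, 'r) ctens)" where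
  "conv_unit \<iota> V W = cext \<iota> W (\<lambda>v. cpure \<iota> W (vscale W (counit V v) (unit W)) 1)"

fun conv_pow :: "('k::field_char_0 \<Rightarrow> 'r::comm_ring_1) \<Rightarrow> ('k, 'v::ab_group_add, 'r) mv_struct \<Rightarrow>
    ('k, 'w::ab_group_add, 'r) mv_struct \<Rightarrow> (('k, 'v, 'r) ctens \<Rightarrow> ('k, 'w, 'r) ctens) \<Rightarrow> nat \<Rightarrow>
    (('k, 'v, 'r) ctens \<Rightarrow> ('k, 'w, 'r) ctens)" where
  "conv_pow \<iota> V W f 0 = conv_unit \<iota> V W"
| "conv_pow \<iota> V W f (Suc n) = conv \<iota> V W f (conv_pow \<iota> V W f n)"

definition conv_exp :: "('k::field_char_0 \<Rightarrow> 'r::comm_ring_1) \<Rightarrow> ('k, 'v::ab_group_add, 'r) mv_struct \<Rightarrow>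
    ('k, 'w::ab_group_add, 'r) mv_struct \<Rightarrow> (('k, 'v, 'r) ctens \<Rightarrow> ('k, 'w, 'r) ctens) \<Rightarrow>
    (('k, 'v, 'r) ctens \<Rightarrow> ('k, 'w, 'r) ctens)" where
  "conv_exp \<iota> V W f x = cseries \<iota> W (\<lambda>n. cscale \<iota> W (\<iota> (1 / fact n)) (conv_pow \<iota> V W f n x))"

definition MV_morphisms :: "('k::field_char_0 \<Rightarrow> 'r::comm_ring_1) \<Rightarrow> ('k, 'v::ab_group_add, 'r) mv_struct \<Rightarrow>
    ('k, 'w::ab_group_add, 'r) mv_struct \<Rightarrow> (('k, 'v, 'r) ctens \<Rightarrow> ('k, 'w, 'r) ctens) set" where
  "MV_morphisms \<iota> V W = {f \<in> Lin0 \<iota> V W. \<forall>x\<in>ctensor \<iota> V.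
     BV W (conv_exp \<iota> V W f x) = conv_exp \<iota> V W f (BV V x)}"

definition QME :: "('k::field_char_0 \<Rightarrow> 'r::comm_ring_1) \<Rightarrow> ('k, 'v::ab_group_add, 'r) mv_struct \<Rightarrow>
    ('k, 'v, 'r) ctens set" where
  "QME \<iota> V = {S \<in> csub_m \<iota> V (grading V 0). BV V (cexp \<iota> V S) = czero \<iota> V}"

definition push_forward :: "('k::field_char_0 \<Rightarrow> 'r::comm_ring_1) \<Rightarrow> ('k, 'v::ab_group_add, 'r) mv_struct \<Rightarrow>
    ('k, 'w::ab_group_add, 'r) mv_struct \<Rightarrow> (('k, 'v, 'r) ctens \<Rightarrow> ('k, 'w, 'r) ctens) \<Rightarrow>
    ('k, 'v, 'r) ctens \<Rightarrow> ('k, 'w, 'r) ctens" where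
  "push_forward \<iota> V W f S = clog \<iota> W (conv_exp \<iota> V W f (cexp \<iota> V S))"

end

theory Submission
  imports Defs "HOL-Computational_Algebra.Formal_Power_Series"
begin

text \<open>
  Write \<open>E = e\<^sup>S\<close>. The theorem holds because \<open>E\<close> is group-like. As \<open>S\<close> is primitive and \<open>V'\<close> is a
  bialgebra, multiplication by \<open>S\<close> on \<open>V'\<close> corresponds under \<open>\<delta>\<close> to multiplication by
  \<open>S \<otimes> 1 + 1 \<otimes> S\<close>. The two summands commute, so \<open>\<delta>(S\<^sup>k)\<close> is given by the binomial formula and
  \<open>\<delta>(E) = E \<otimes> E\<close> (\<open>coev_cpow\<close>, \<open>cexp_grouplike\<close>). Applying \<open>f \<star> g\<close> to a group-like element gives
  the product \<open>f(E) g(E)\<close> (\<open>conv_grouplike\<close>), and the unit \<open>\<eta>\<epsilon>\<close> of the convolution algebra sends \<open>E\<close>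
  to \<open>1\<close> because the counit vanishes on primitive elements. Hence \<open>f\<^bsup>\<star>k\<^esup>(E) = f(E)\<^sup>k\<close> for all \<open>k\<close>
  (\<open>conv_pow_cexp\<close>), that is \<open>exp(f)(E) = e\<^bsup>f(E)\<^esup>\<close>. Modulo \<open>\<mm>\<close> the element \<open>E\<close> is \<open>1\<close> and
  \<open>f(1)\<close> vanishes, so \<open>f(E)\<close> lies in the completed tensor product with \<open>\<mm>\<close>; there the logarithm
  inverts the exponential (\<open>clog_cexp\<close>), and \<open>f\<^sub>!(S) = log(e\<^bsup>f(E)\<^esup>) = f(E)\<close>.

  Completed tensor products are inverse limits of quotients of free vector spaces, so every identity
  above is an identity of cosets. It is checked by duality: over a field a subspace is
  the common kernel of the functionals that annihilate it (\<open>mem_fspan_iff\<close>), and the functionals on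
  \<open>V \<otimes> R / V \<otimes> \<mm>\<^sup>n\<close> are the \<open>\<k>\<close>-bilinear forms on \<open>V \<times> R\<close> that kill \<open>V \<times> \<mm>\<^sup>n\<close>. An element
  is determined by the values of all these forms (\<open>ctensor_eqI\<close>), each operation acts on the
  values by a simple rule, and interchanging the factors of a tensor product becomes interchanging
  two finite sums. The same device replaces the space \<open>V \<otimes> V \<otimes> R\<close>, in which \<open>\<delta>(E)\<close> lives, by
  trilinear forms.

  Koszul signs enter through the product of \<open>V \<otimes> V\<close>. They disappear because \<open>S\<close> has degree \<open>0\<close>,
  but at a given level the degree is visible on one representative of \<open>S\<close> and primitivity on another one.
  In \<open>coev_cmul\<close> the expression is therefore written as a form in \<open>S\<close> after each of the two steps,
  which permits a change of representative in between.
\<close>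


section \<open>Linear functionals on formal combinations\<close>

definition feval :: "('x \<Rightarrow> 'k::field) \<Rightarrow> ('x \<Rightarrow>\<^sub>0 'k) \<Rightarrow> 'k" where
  "feval h t = (\<Sum>x\<in>Poly_Mapping.keys t. Poly_Mapping.lookup t x * h x)"

lemma feval_superset:
  assumes "finite A" "Poly_Mapping.keys t \<subseteq> A"
  shows "feval h t = (\<Sum>x\<in>A. Poly_Mapping.lookup t x * h x)"
  unfolding feval_def using assms
  by (intro sum.mono_neutral_left) (auto simp: in_keys_iff)

lemma feval_0 [simp]: "feval h 0 = 0"
  by (simp add: feval_def)

lemma feval_add: "feval h (s + t) = feval h s + feval h t"
proof -
  let ?A = "Poly_Mapping.keys s \<union> Poly_Mapping.keys t"
  have "Poly_Mapping.keys (s + t) \<subseteq> ?A"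
    by (rule Poly_Mapping.keys_add)
  then show ?thesis
    by (simp add: feval_superset[of ?A] lookup_add sum.distrib distrib_right)
qed

lemma feval_fscale: "feval h (fscale c t) = c * feval h t"
proof -
  have "Poly_Mapping.keys (fscale c t) \<subseteq> Poly_Mapping.keys t"
    by (auto simp: in_keys_iff lookup_fscale)
  then show ?thesis
    by (simp add: feval_superset[of "Poly_Mapping.keys t"] lookup_fscale sum_distrib_left mult.assoc)
qed

lemma feval_uminus: "feval h (- t) = - feval h t"
  using feval_add[of h "- t" t] by (simp add: eq_neg_iff_add_eq_0)

lemma feval_diff: "feval h (s - t) = feval h s - feval h t"
  using feval_add[of h s "- t"] by (simp add: feval_uminus)

lemma feval_gen [simp]: "feval h (gen x) = h x"
  by (simp add: feval_def)

lemma feval_sum: "feval h (\<Sum>i\<in>I. T i) = (\<Sum>i\<in>I. feval h (T i))"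
  by (induction I rule: infinite_finite_induct) (simp_all add: feval_add)

lemma feval_flin: "feval h (flin F t) = feval (\<lambda>x. feval h (F x)) t"
  by (simp add: flin_def feval_sum feval_fscale feval_def[of "\<lambda>x. feval h (F x)"])

lemma feval_swap:
  "feval (\<lambda>x. feval (\<lambda>y. h x y) t) s = feval (\<lambda>y. feval (\<lambda>x. h x y) s) t"
  unfolding feval_def sum_distrib_left by (subst sum.swap) (simp add: mult.left_commute)

lemma feval_fun_add: "feval (\<lambda>x. h x + h' x) t = feval h t + feval h' t"
  by (simp add: feval_def distrib_left sum.distrib)

lemma feval_fun_cmult: "feval (\<lambda>x. c * h x) t = c * feval h t"
  by (simp add: feval_def sum_distrib_left mult.left_commute)

lemma feval_fun_0: "feval (\<lambda>x. 0) t = 0"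
  by (simp add: feval_def)

lemma feval_fun_sum: "feval (\<lambda>x. \<Sum>i\<in>I. h i x) t = (\<Sum>i\<in>I. feval (h i) t)"
  by (induction I rule: infinite_finite_induct) (simp_all add: feval_fun_add feval_fun_0)

lemma feval_cong:
  "(\<And>x. x \<in> Poly_Mapping.keys t \<Longrightarrow> h x = h' x) \<Longrightarrow> feval h t = feval h' t"
  by (simp add: feval_def)

lemma formal_combination_expand: "t = (\<Sum>x\<in>Poly_Mapping.keys t. fscale (Poly_Mapping.lookup t x) (gen x))"
proof (rule poly_mapping_eqI)
  fix x
  have "(\<Sum>y\<in>Poly_Mapping.keys t. Poly_Mapping.lookup t y * Poly_Mapping.lookup (gen y) x)
      = (\<Sum>y\<in>Poly_Mapping.keys t. if y = x then Poly_Mapping.lookup t y else 0)"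
    by (intro sum.cong) (auto simp: lookup_single when_def)
  then show "Poly_Mapping.lookup t x = Poly_Mapping.lookup (\<Sum>x\<in>Poly_Mapping.keys t. fscale (Poly_Mapping.lookup t x) (gen x)) x"
    by (auto simp: lookup_sum lookup_fscale in_keys_iff)
qed

text \<open>
  A vector outside a subspace is separated from it by a functional, obtained by completing a basis of
  the subspace; and on a free vector space every functional is of the form \<open>feval h\<close>. Through this
  lemma membership in the relations of a tensor product is tested by multilinear forms.
\<close>

lemma mem_fspan_iff:
  fixes t :: "'x \<Rightarrow>\<^sub>0 'k::field"
  shows "t \<in> fspan G \<longleftrightarrow> (\<forall>h. (\<forall>g\<in>G. feval h g = 0) \<longrightarrow> feval h t = 0)"
proof
  interpret fs: vector_space "fscale :: 'k \<Rightarrow> ('x \<Rightarrow>\<^sub>0 'k) \<Rightarrow> _" by (rule vector_space_fscale)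
  assume "t \<in> fspan G"
  then have "t \<in> fs.span G" by (simp add: fspan_def)
  then show "\<forall>h. (\<forall>g\<in>G. feval h g = 0) \<longrightarrow> feval h t = 0"
    by (induction rule: fs.span_induct_alt) (auto simp: feval_add feval_fscale)
next
  interpret fs: vector_space "fscale :: 'k \<Rightarrow> ('x \<Rightarrow>\<^sub>0 'k) \<Rightarrow> _" by (rule vector_space_fscale)
  interpret vp: vector_space_pair "fscale :: 'k \<Rightarrow> ('x \<Rightarrow>\<^sub>0 'k) \<Rightarrow> _" "(*) :: 'k \<Rightarrow> _"
    by unfold_locales (auto simp: algebra_simps)
  assume *: "\<forall>h. (\<forall>g\<in>G. feval h g = 0) \<longrightarrow> feval h t = 0"
  show "t \<in> fspan G"
  proof (rule ccontr)
    assume "t \<notin> fspan G"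
    then have t: "t \<notin> fs.span G" by (simp add: fspan_def)
    obtain B where B: "B \<subseteq> G" "fs.independent B" "fs.span B = fs.span G"
      using fs.maximal_independent_subset[of G]
      by (metis fs.span_eq subset_trans fs.span_superset fs.span_mono)
    then have "fs.independent (insert t B)"
      using t by (simp add: fs.independent_insertI)
    then obtain \<phi> where \<phi>: "Vector_Spaces.linear fscale (*) \<phi>" "\<forall>x\<in>insert t B. \<phi> x = (if x = t then 1 else 0)"
      using vp.linear_independent_extend[of _ "\<lambda>x. if x = t then 1 else 0"] by blast
    interpret lp: Vector_Spaces.linear "fscale :: 'k \<Rightarrow> ('x \<Rightarrow>\<^sub>0 'k) \<Rightarrow> _" "(*)" \<phi> by fact
    have ev: "feval (\<lambda>x. \<phi> (gen x)) s = \<phi> s" for s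
    proof -
      have "\<phi> s = \<phi> (\<Sum>x\<in>Poly_Mapping.keys s. fscale (Poly_Mapping.lookup s x) (gen x))"
        using formal_combination_expand[of s] by simp
      then show ?thesis by (simp add: lp.sum lp.scale feval_def)
    qed
    have "t \<notin> B" using t B by (metis fs.span_base)
    then have \<phi>0: "\<phi> b = 0" if "b \<in> B" for b
      using \<phi>(2) that by auto
    have "\<phi> g = 0" if "g \<in> fs.span B" for g
      using that by (induction rule: fs.span_induct_alt) (auto simp: lp.add lp.scale \<phi>0)
    then have "\<forall>g\<in>G. feval (\<lambda>x. \<phi> (gen x)) g = 0"
      using B(3) fs.span_base ev by auto
    with * have "\<phi> t = 0" by (metis ev)
    with \<phi>(2) show False by simp
  qed
qed

lemma zero_in_fspan: "0 \<in> fspan G"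
  by (simp add: mem_fspan_iff)

lemma mem_coset_iff: "s \<in> t +o fspan G \<longleftrightarrow> s - t \<in> fspan G"
  by (auto simp: elt_set_plus_def) (metis add.commute diff_add_cancel)

lemma coset_eq_iff: "s +o fspan G = t +o fspan G \<longleftrightarrow> s - t \<in> fspan G"
proof
  assume "s +o fspan G = t +o fspan G"
  moreover have "s \<in> s +o fspan G" by (simp add: mem_coset_iff zero_in_fspan)
  ultimately show "s - t \<in> fspan G" by (simp add: mem_coset_iff)
next
  assume "s - t \<in> fspan G"
  then show "s +o fspan G = t +o fspan G"
    by (auto simp: mem_coset_iff mem_fspan_iff feval_diff)
qed

lemma coset_add: "(s +o fspan G) + (t +o fspan G) = (s + t) +o fspan G"
proof (intro equalityI subsetI)
  fix x assume "x \<in> (s +o fspan G) + (t +o fspan G)"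
  then obtain a b where "a - s \<in> fspan G" "b - t \<in> fspan G" "x = a + b"
    by (auto simp: set_plus_def mem_coset_iff)
  then show "x \<in> (s + t) +o fspan G"
    by (auto simp: mem_coset_iff mem_fspan_iff feval_diff feval_add)
next
  fix x assume "x \<in> (s + t) +o fspan G"
  then have "x - t \<in> s +o fspan G" "t \<in> t +o fspan G"
    by (auto simp: mem_coset_iff mem_fspan_iff feval_diff feval_add diff_diff_eq2 algebra_simps)
  then show "x \<in> (s +o fspan G) + (t +o fspan G)"
    by (metis diff_add_cancel set_plus_intro)
qed

lemma rep_in: "x \<in> A \<Longrightarrow> rep A \<in> A"
  unfolding rep_def by (rule someI)

lemma self_in_coset: "t \<in> t +o fspan G"
  by (simp add: mem_coset_iff zero_in_fspan)

lemma feval_coset: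
  assumes "\<forall>g\<in>G. feval h g = 0" "s \<in> t +o fspan G"
  shows "feval h s = feval h t"
  using assms by (auto simp: mem_coset_iff mem_fspan_iff feval_diff)


section \<open>Powers of the maximal ideal\<close>

lemma module_mult: "module ((*) :: 'r::comm_ring_1 \<Rightarrow> 'r \<Rightarrow> 'r)"
  by unfold_locales (auto simp: algebra_simps)

lemma max_ideal_pow_subspace: "module.subspace (*) (max_ideal_pow n :: 'r::comm_ring_1 set)"
proof (cases n)
  case 0
  then show ?thesis by (simp add: module.subspace_UNIV[OF module_mult])
next
  case (Suc k)
  then show ?thesis by (simp add: module.subspace_span[OF module_mult])
qed

lemma max_ideal_pow_mult_left: "s \<in> max_ideal_pow n \<Longrightarrow> r * s \<in> max_ideal_pow n"
  using module.subspace_scale[OF module_mult max_ideal_pow_subspace] by blast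

lemma max_ideal_pow_mult:
  assumes "r \<in> max_ideal_pow i" "s \<in> max_ideal_pow j"
  shows "(r * s :: 'r::comm_ring_1) \<in> max_ideal_pow (i + j)"
  using assms
proof (induction i arbitrary: r s j)
  case 0
  then show ?case by (simp add: max_ideal_pow_mult_left)
next
  case (Suc i)
  interpret m: module "(*) :: 'r \<Rightarrow> 'r \<Rightarrow> 'r" by (rule module_mult)
  let ?G = "{a * b | a b. a \<in> max_ideal \<and> b \<in> (max_ideal_pow i :: 'r set)}"
  have "r \<in> m.span ?G" using Suc.prems by simp
  then show ?case
  proof (induction rule: m.span_induct_alt)
    case base
    show ?case using m.subspace_0[OF max_ideal_pow_subspace[of "Suc i + j"]] by (simp only: mult_zero_left)
  next
    case (step c x y)
    then obtain a b where ab: "x = a * b" "a \<in> max_ideal" "b \<in> max_ideal_pow i" by auto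
    then have "b * s \<in> max_ideal_pow (i + j)" using Suc by blast
    with ab have "a * (b * s) \<in> max_ideal_pow (Suc (i + j))"
      unfolding max_ideal_pow.simps by (intro m.span_base) blast
    then have "c * (a * (b * s)) \<in> max_ideal_pow (Suc i + j)"
      by (metis add_Suc max_ideal_pow_mult_left)
    moreover have "(c * x + y) * s = c * (a * (b * s)) + y * s"
      unfolding ab(1) by (simp only: distrib_right mult.assoc)
    ultimately show ?case
      using step.IH m.subspace_add[OF max_ideal_pow_subspace[of "Suc i + j"]] by metis
  qed
qed

lemma max_ideal_pow_antimono:
  assumes "n \<le> m" shows "(max_ideal_pow m :: 'r::comm_ring_1 set) \<subseteq> max_ideal_pow n"
proof -
  have "(max_ideal_pow (Suc l) :: 'r set) \<subseteq> max_ideal_pow l" for l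
    unfolding max_ideal_pow.simps
  proof (rule module.span_minimal[OF module_mult])
    show "{a * b | a b. a \<in> max_ideal \<and> b \<in> max_ideal_pow l} \<subseteq> (max_ideal_pow l :: 'r set)"
      using max_ideal_pow_mult_left by blast
  qed (rule max_ideal_pow_subspace)
  then show ?thesis
    by (rule lift_Suc_antimono_le[of "\<lambda>l. max_ideal_pow l :: 'r set"]) fact
qed

lemma max_ideal_subset_pow_1: "(max_ideal :: 'r::comm_ring_1 set) \<subseteq> max_ideal_pow 1"
proof
  interpret m: module "(*) :: 'r \<Rightarrow> 'r \<Rightarrow> 'r" by (rule module_mult)
  fix r :: 'r assume "r \<in> max_ideal"
  then have "r * 1 \<in> {a * b | a b. a \<in> max_ideal \<and> b \<in> (UNIV :: 'r set)}" by blast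
  then have "r * 1 \<in> max_ideal_pow (Suc 0)"
    unfolding max_ideal_pow.simps by (rule m.span_base)
  then show "r \<in> max_ideal_pow 1" by simp
qed


section \<open>Separating the completed tensor product by forms\<close>

text \<open>
  In curried form, the linear functionals on \<open>V \<otimes> R / V \<otimes> \<mm>\<^sup>n\<close>.
\<close>

definition adic_form :: "('k::field \<Rightarrow> 'r::comm_ring_1) \<Rightarrow> ('k, 'v::ab_group_add, 'z) alg_coalg_scheme \<Rightarrow>
    nat \<Rightarrow> ('v \<Rightarrow> 'r \<Rightarrow> 'k) \<Rightarrow> bool" where
  "adic_form \<iota> V n h \<longleftrightarrow>
     (\<forall>u v r. h (u + v) r = h u r + h v r) \<and> (\<forall>v r s. h v (r + s) = h v r + h v s) \<and>
     (\<forall>c v r. h (vscale V c v) r = c * h v r) \<and> (\<forall>c v r. h v (\<iota> c * r) = c * h v r) \<and>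
     (\<forall>v. \<forall>r\<in>max_ideal_pow n. h v r = 0)"

lemma adic_formD:
  assumes "adic_form \<iota> V n h"
  shows "h (u + v) r = h u r + h v r" "h v (r + s) = h v r + h v s"
    "h (vscale V c v) r = c * h v r" "h v (\<iota> c * r) = c * h v r"
    "r \<in> max_ideal_pow n \<Longrightarrow> h v r = 0"
  using assms by (simp_all add: adic_form_def)

lemma adic_form_zero:
  assumes "adic_form \<iota> V n h" shows "h 0 r = 0" "h v 0 = 0"
  using adic_formD(1)[OF assms, of 0 0 r] adic_formD(2)[OF assms, of v 0 0]
  by (simp_all only: add_0 add_cancel_right_right)

lemma adic_form_0: "adic_form \<iota> V 0 h \<Longrightarrow> h v r = 0"
  using adic_formD(5)[of \<iota> V 0 h r v] by simp

lemma adic_form_mono: "adic_form \<iota> V n h \<Longrightarrow> n \<le> m \<Longrightarrow> adic_form \<iota> V m h"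
  using max_ideal_pow_antimono[of n m] by (auto simp: adic_form_def)

text \<open>
  The relations occur as a span inside a larger generating set; functionals do not see the difference.
\<close>

lemma fspan_Un_annihilated:
  "(\<forall>g\<in>fspan G \<union> M. feval H g = 0) \<longleftrightarrow> (\<forall>g\<in>G \<union> M. feval H g = 0)"
proof -
  have "\<forall>g\<in>G. feval H g = 0 \<Longrightarrow> g \<in> fspan G \<Longrightarrow> feval H g = 0" for g
    by (simp add: mem_fspan_iff)
  moreover have "g \<in> fspan G" if "g \<in> G" for g
    using that by (simp add: mem_fspan_iff)
  ultimately show ?thesis by blast
qed

text \<open>
  A functional on the free space kills the defining relations exactly when the corresponding function
  of two variables is bilinear, so the forms detect the whole subspace.
\<close>

lemma mem_adic_iff:
  "t \<in> adic \<iota> V n \<longleftrightarrow> (\<forall>h. adic_form \<iota> V n h \<longrightarrow> feval (\<lambda>p. h (fst p) (snd p)) t = 0)"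
proof -
  let ?G = "{gen (u + v, r) - gen (u, r) - gen (v, r) | u v r. True} \<union>
      {gen (v, r + s) - gen (v, r) - gen (v, s) | v r s. True} \<union>
      {gen (vscale V c v, r) - fscale c (gen (v, r)) | c v r. True} \<union>
      {gen (v, \<iota> c * r) - fscale c (gen (v, r)) | c v r. True}"
  let ?M = "{gen (v, r) | v r. r \<in> max_ideal_pow n}"
  note rel = fspan_Un_annihilated[of ?G ?M]
  have form: "(\<forall>g\<in>?G \<union> ?M. feval H g = 0) \<longleftrightarrow> adic_form \<iota> V n (\<lambda>v r. H (v, r))" for H
  proof
    assume *: "\<forall>g\<in>?G \<union> ?M. feval H g = 0"
    have "feval H (gen (u + v, r) - gen (u, r) - gen (v, r)) = 0" for u v r
      by (rule bspec[OF *]) blast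
    moreover have "feval H (gen (v, r + s) - gen (v, r) - gen (v, s)) = 0" for v r s
      by (rule bspec[OF *]) blast
    moreover have "feval H (gen (vscale V c v, r) - fscale c (gen (v, r))) = 0" for c v r
      by (rule bspec[OF *]) blast
    moreover have "feval H (gen (v, \<iota> c * r) - fscale c (gen (v, r))) = 0" for c v r
      by (rule bspec[OF *]) blast
    moreover have "feval H (gen (v, r)) = 0" if "r \<in> max_ideal_pow n" for v r
      by (rule bspec[OF *]) (use that in blast)
    ultimately show "adic_form \<iota> V n (\<lambda>v r. H (v, r))"
      by (simp add: adic_form_def feval_diff feval_fscale feval_add diff_diff_eq)
  next
    assume "adic_form \<iota> V n (\<lambda>v r. H (v, r))"
    note D = adic_formD[OF this]
    show "\<forall>g\<in>?G \<union> ?M. feval H g = 0"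
      by (intro ballI; elim UnE CollectE exE conjE; simp add: feval_diff feval_fscale D)
  qed
  show ?thesis
    unfolding adic_def tensor_rel_def mem_fspan_iff[of t] rel form
  proof (intro iffI allI impI)
    fix h assume *: "\<forall>H. adic_form \<iota> V n (\<lambda>v r. H (v, r)) \<longrightarrow> feval H t = 0" "adic_form \<iota> V n h"
    show "feval (\<lambda>p. h (fst p) (snd p)) t = 0"
      using *(2) *(1)[rule_format, of "\<lambda>p. h (fst p) (snd p)"] by simp
  next
    fix H assume *: "\<forall>h. adic_form \<iota> V n h \<longrightarrow> feval (\<lambda>p. h (fst p) (snd p)) t = 0"
      "adic_form \<iota> V n (\<lambda>v r. H (v, r))"
    have "feval (\<lambda>p. H (fst p, snd p)) t = 0" by (rule *(1)[rule_format, OF *(2)])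
    then show "feval H t = 0" by simp
  qed
qed


text \<open>
  The value of the functional \<open>h\<close> on the component of \<open>x\<close> at level \<open>n\<close>. It depends only on
  the coset when \<open>h\<close> is an \<open>adic_form\<close> of level \<open>n\<close>.
\<close>

definition cpair :: "nat \<Rightarrow> ('v \<Rightarrow> 'r \<Rightarrow> 'k::field) \<Rightarrow> ('k, 'v, 'r) ctens \<Rightarrow> 'k" where
  "cpair n h x = feval (\<lambda>p. h (fst p) (snd p)) (rep (x n))"

lemma cpair_fun_add: "cpair n (\<lambda>v r. h v r + h' v r) x = cpair n h x + cpair n h' x"
  by (simp add: cpair_def feval_fun_add)

lemma cpair_fun_cmult: "cpair n (\<lambda>v r. c * h v r) x = c * cpair n h x"
  by (simp add: cpair_def feval_fun_cmult)

lemma cpair_fun_0 [simp]: "cpair n (\<lambda>v r. 0) x = 0"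
  by (simp add: cpair_def feval_fun_0)

lemma cpair_fun_sum: "cpair n (\<lambda>v r. \<Sum>i\<in>I. h i v r) x = (\<Sum>i\<in>I. cpair n (h i) x)"
  by (simp add: cpair_def feval_fun_sum)

text \<open>
  The interchange of tensor factors: both sides are the same finite double sum.
\<close>

lemma cpair_swap:
  "cpair n (\<lambda>v r. cpair m (\<lambda>w s. h v r w s) y) x = cpair m (\<lambda>w s. cpair n (\<lambda>v r. h v r w s) x) y"
  unfolding cpair_def by (rule feval_swap)

lemma cpair_feval_swap:
  "cpair n (\<lambda>v r. feval (\<lambda>z. h v r z) t) x = feval (\<lambda>z. cpair n (\<lambda>v r. h v r z) x) t"
  unfolding cpair_def by (rule feval_swap)

lemma adic_fspan: "\<exists>G. adic \<iota> V n = fspan G"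
  by (auto simp: adic_def)

lemma mem_adic_coset_iff:
  "s \<in> t +o adic \<iota> V n \<longleftrightarrow> (\<forall>h. adic_form \<iota> V n h \<longrightarrow>
     feval (\<lambda>p. h (fst p) (snd p)) s = feval (\<lambda>p. h (fst p) (snd p)) t)"
proof -
  have "s \<in> t +o adic \<iota> V n \<longleftrightarrow> s - t \<in> adic \<iota> V n"
    using adic_fspan[of \<iota> V n] by (metis mem_coset_iff)
  then show ?thesis by (simp add: mem_adic_iff feval_diff)
qed

lemma adic_coset_eq_iff:
  "s +o adic \<iota> V n = t +o adic \<iota> V n \<longleftrightarrow> (\<forall>h. adic_form \<iota> V n h \<longrightarrow>
     feval (\<lambda>p. h (fst p) (snd p)) s = feval (\<lambda>p. h (fst p) (snd p)) t)"
  by (auto simp: set_eq_iff mem_adic_coset_iff)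

lemma feval_rep_adic:
  "adic_form \<iota> V n h \<Longrightarrow>
     feval (\<lambda>p. h (fst p) (snd p)) (rep (a +o adic \<iota> V n)) = feval (\<lambda>p. h (fst p) (snd p)) a"
  using rep_in[of a "a +o adic \<iota> V n"] by (simp add: mem_adic_coset_iff)

lemma cpair_level:
  "x n = a +o adic \<iota> V n \<Longrightarrow> adic_form \<iota> V n h \<Longrightarrow> cpair n h x = feval (\<lambda>p. h (fst p) (snd p)) a"
  by (simp add: cpair_def feval_rep_adic)

lemma ctensor_mem:
  assumes "x \<in> ctensor \<iota> V" "a \<in> x n" shows "x n = a +o adic \<iota> V n"
proof -
  obtain b where b: "x n = b +o adic \<iota> V n"
    using assms(1) unfolding ctensor_def csub_def by blast
  then show ?thesis
    using assms(2) by (auto simp: adic_coset_eq_iff mem_adic_coset_iff)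
qed

lemma ctensor_rep:
  assumes "x \<in> ctensor \<iota> V" shows "x n = rep (x n) +o adic \<iota> V n"
proof -
  obtain b where b: "x n = b +o adic \<iota> V n"
    using assms(1) unfolding ctensor_def csub_def by blast
  then have "b \<in> x n" by (simp add: mem_adic_coset_iff)
  then show ?thesis using assms rep_in ctensor_mem by metis
qed

lemma cpair_mem:
  "x \<in> ctensor \<iota> V \<Longrightarrow> a \<in> x n \<Longrightarrow> adic_form \<iota> V n h \<Longrightarrow>
     cpair n h x = feval (\<lambda>p. h (fst p) (snd p)) a"
  by (rule cpair_level[OF ctensor_mem])

text \<open>
  Compatibility of the levels, tested by forms. A form of level \<open>n\<close> is also one of level \<open>n + 1\<close>,
  and the lemma asks that it takes the same value on both representatives.
\<close>

lemma ctensorI: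
  assumes x: "\<And>n. x n = a n +o adic \<iota> V n"
    and compat: "\<And>n h. adic_form \<iota> V n h \<Longrightarrow>
      feval (\<lambda>p. h (fst p) (snd p)) (a (Suc n)) = feval (\<lambda>p. h (fst p) (snd p)) (a n)"
  shows "x \<in> ctensor \<iota> V"
  unfolding ctensor_def csub_def
proof (intro CollectI conjI allI)
  fix n
  show "\<exists>a. Poly_Mapping.keys a \<subseteq> UNIV \<times> UNIV \<and> x n = a +o adic \<iota> V n"
    using x by auto
  show "x (Suc n) \<subseteq> x n"
  proof
    fix b assume "b \<in> x (Suc n)"
    then show "b \<in> x n"
      unfolding x mem_adic_coset_iff using compat adic_form_mono[of \<iota> V n _ "Suc n"] by auto
  qed
qed

text \<open>
  All levels come from one element of the inverse limit, so a form may be evaluated at any level at which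
  it is defined.
\<close>

lemma cpair_eq_level:
  assumes x: "x \<in> ctensor \<iota> V" and h: "adic_form \<iota> V n h" "adic_form \<iota> V m h"
  shows "cpair n h x = cpair m h x"
proof -
  have mono: "x l \<subseteq> x k" if "k \<le> l" for k l
    using that
  proof (induction l rule: dec_induct)
    case (step l)
    then show ?case using x unfolding ctensor_def csub_def by blast
  qed simp
  have "cpair k h x = cpair l h x" if "k \<le> l" "adic_form \<iota> V k h" "adic_form \<iota> V l h" for k l
  proof -
    have "rep (x l) \<in> x l" using ctensor_rep[OF x] by (metis mem_adic_coset_iff)
    then have "rep (x l) \<in> x k" using mono that by blast
    then show ?thesis using cpair_mem[OF x _ that(2)] by (simp add: cpair_def)
  qed
  then show ?thesis using h by (metis nat_le_linear)
qed

lemma ctensor_level_eqI: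
  assumes "x \<in> ctensor \<iota> V" "y \<in> ctensor \<iota> V"
    and "\<And>h. adic_form \<iota> V n h \<Longrightarrow> cpair n h x = cpair n h y"
  shows "x n = y n"
proof -
  have "rep (x n) +o adic \<iota> V n = rep (y n) +o adic \<iota> V n"
    using assms(3) by (simp add: adic_coset_eq_iff cpair_def)
  then show ?thesis
    using ctensor_rep[OF assms(1)] ctensor_rep[OF assms(2)] by simp
qed

text \<open>
  This reduces every identity in the completed tensor product to identities in the field.
\<close>

lemma ctensor_eqI:
  assumes "x \<in> ctensor \<iota> V" "y \<in> ctensor \<iota> V"
    and "\<And>n h. adic_form \<iota> V n h \<Longrightarrow> cpair n h x = cpair n h y"
  shows "x = y"
  using ctensor_level_eqI[OF assms(1,2)] assms(3) by blast


section \<open>The algebra structure in terms of forms\<close>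

lemma cpair_cpure: "adic_form \<iota> V n h \<Longrightarrow> cpair n h (cpure \<iota> V v r) = h v r"
  by (subst cpair_level[of _ _ "gen (v, r)"]) (auto simp: cpure_def)

lemma cpure_in: "cpure \<iota> V v r \<in> ctensor \<iota> V"
  by (rule ctensorI[of _ "\<lambda>_. gen (v, r)"]) (auto simp: cpure_def)

lemma czero_level: "czero \<iota> V n = 0 +o adic \<iota> V n"
  by (simp add: czero_def elt_set_plus_def)

lemma czero_in: "czero \<iota> V \<in> ctensor \<iota> V"
  by (rule ctensorI[of _ "\<lambda>_. 0"]) (auto simp: czero_level)

lemma cpair_czero: "adic_form \<iota> V n h \<Longrightarrow> cpair n h (czero \<iota> V) = 0"
  by (subst cpair_level[of "czero \<iota> V" n, OF czero_level]) auto

lemma cone_in: "cone \<iota> V \<in> ctensor \<iota> V"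
  by (simp add: cone_def cpure_in)

lemma cpair_cone: "adic_form \<iota> V n h \<Longrightarrow> cpair n h (cone \<iota> V) = h (unit V) 1"
  by (simp add: cone_def cpair_cpure)

lemma cadd_level:
  assumes "x \<in> ctensor \<iota> V" "y \<in> ctensor \<iota> V"
  shows "cadd x y n = (rep (x n) + rep (y n)) +o adic \<iota> V n"
  unfolding cadd_def using ctensor_rep[OF assms(1), of n] ctensor_rep[OF assms(2), of n] adic_fspan[of \<iota> V n]
  by (metis coset_add)

lemma cpair_cadd:
  assumes "x \<in> ctensor \<iota> V" "y \<in> ctensor \<iota> V" "adic_form \<iota> V n h"
  shows "cpair n h (cadd x y) = cpair n h x + cpair n h y"
  by (subst cpair_level[of "cadd x y" n, OF cadd_level[OF assms(1,2)] assms(3)]) (simp add: feval_add cpair_def)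

lemma cpair_Suc:
  "x \<in> ctensor \<iota> V \<Longrightarrow> adic_form \<iota> V n h \<Longrightarrow> cpair (Suc n) h x = cpair n h x"
  using cpair_eq_level[of x \<iota> V "Suc n" h n] adic_form_mono[of \<iota> V n h "Suc n"] by simp

lemma cadd_in:
  assumes "x \<in> ctensor \<iota> V" "y \<in> ctensor \<iota> V" shows "cadd x y \<in> ctensor \<iota> V"
proof (rule ctensorI[OF cadd_level[OF assms]])
  fix n h assume h: "adic_form \<iota> V n h"
  show "feval (\<lambda>p. h (fst p) (snd p)) (rep (x (Suc n)) + rep (y (Suc n)))
      = feval (\<lambda>p. h (fst p) (snd p)) (rep (x n) + rep (y n))"
    using cpair_Suc[OF assms(1) h] cpair_Suc[OF assms(2) h] by (simp add: feval_add cpair_def)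
qed

lemma adic_form_scale: "adic_form \<iota> V n h \<Longrightarrow> adic_form \<iota> V n (\<lambda>v s. h v (r * s))"
  unfolding adic_form_def by (simp add: distrib_left mult.left_commute[of r] max_ideal_pow_mult_left)

lemma feval_rmul:
  "feval (\<lambda>p. h (fst p) (snd p)) (rmul r t) = feval (\<lambda>p. h (fst p) (r * snd p)) t"
  by (simp add: rmul_def feval_flin case_prod_beta)

lemma cpair_cscale:
  "adic_form \<iota> V n h \<Longrightarrow> cpair n h (cscale \<iota> V r x) = cpair n (\<lambda>v s. h v (r * s)) x"
  by (subst cpair_level[of "cscale \<iota> V r x" n "rmul r (rep (x n))"])
     (auto simp: cscale_def feval_rmul cpair_def)

lemma cpair_cscale_const:
  "adic_form \<iota> V n h \<Longrightarrow> cpair n h (cscale \<iota> V (\<iota> c) x) = c * cpair n h x"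
  by (simp add: cpair_cscale adic_formD cpair_fun_cmult)

lemma cscale_in:
  assumes "x \<in> ctensor \<iota> V" shows "cscale \<iota> V r x \<in> ctensor \<iota> V"
proof (rule ctensorI[of _ "\<lambda>n. rmul r (rep (x n))"])
  fix n h assume h: "adic_form \<iota> V n h"
  show "feval (\<lambda>p. h (fst p) (snd p)) (rmul r (rep (x (Suc n))))
      = feval (\<lambda>p. h (fst p) (snd p)) (rmul r (rep (x n)))"
    using cpair_Suc[OF assms adic_form_scale[OF h]] by (simp add: feval_rmul cpair_def)
qed (simp add: cscale_def)

text \<open>
  In curried form, the functionals on \<open>V \<otimes> V \<otimes> R / V \<otimes> V \<otimes> \<mm>\<^sup>n\<close>.
\<close>

definition adic_form2 :: "('k::field \<Rightarrow> 'r::comm_ring_1) \<Rightarrow> ('k, 'v::ab_group_add, 'z) alg_coalg_scheme \<Rightarrow>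
    nat \<Rightarrow> ('v \<Rightarrow> 'v \<Rightarrow> 'r \<Rightarrow> 'k) \<Rightarrow> bool" where
  "adic_form2 \<iota> V n b \<longleftrightarrow>
     (\<forall>v. adic_form \<iota> V n (\<lambda>w t. b v w t)) \<and> (\<forall>w. adic_form \<iota> V n (\<lambda>v t. b v w t))"

text \<open>
  The value of \<open>b\<close> on the image of \<open>x \<otimes> y\<close> under
  \<open>(V \<otimes> R) \<otimes> (V \<otimes> R) \<rightarrow> V \<otimes> V \<otimes> R\<close>. A product is the case where \<open>b\<close> factors through the
  multiplication of \<open>V\<close>.
\<close>

definition cpair2 :: "nat \<Rightarrow> ('v \<Rightarrow> 'v \<Rightarrow> 'r::comm_ring_1 \<Rightarrow> 'k::field) \<Rightarrow>
    ('k, 'v, 'r) ctens \<Rightarrow> ('k, 'v, 'r) ctens \<Rightarrow> 'k" where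
  "cpair2 n b x y = cpair n (\<lambda>v r. cpair n (\<lambda>w s. b v w (r * s)) y) x"

lemma cpair2_swap: "cpair2 n b x y = cpair n (\<lambda>w s. cpair n (\<lambda>v r. b v w (r * s)) x) y"
  unfolding cpair2_def by (rule cpair_swap)

lemma adic_form2_inner:
  "adic_form2 \<iota> V n b \<Longrightarrow> adic_form \<iota> V n (\<lambda>w s. b v w (r * s))"
  "adic_form2 \<iota> V n b \<Longrightarrow> adic_form \<iota> V n (\<lambda>v r. b v w (r * s))"
  using adic_form_scale[of \<iota> V n "\<lambda>w t. b v w t" r] adic_form_scale[of \<iota> V n "\<lambda>v t. b v w t" s]
  by (simp_all add: adic_form2_def mult.commute)

lemma adic_form2_outer:
  assumes "adic_form2 \<iota> V n b"
  shows "adic_form \<iota> V n (\<lambda>v r. cpair n (\<lambda>w s. b v w (r * s)) y)"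
proof -
  note D = adic_formD[OF adic_form2_inner(2)[OF assms]]
  show ?thesis
    unfolding adic_form_def by (simp add: D cpair_fun_add cpair_fun_cmult)
qed

lemma adic_form2_outer':
  assumes "adic_form2 \<iota> V n b"
  shows "adic_form \<iota> V n (\<lambda>w s. cpair n (\<lambda>v r. b v w (r * s)) x)"
proof -
  note D = adic_formD[OF adic_form2_inner(1)[OF assms]]
  show ?thesis
    unfolding adic_form_def by (simp add: D cpair_fun_add cpair_fun_cmult)
qed

text \<open>
  In terms of forms: \<open>x\<close> is zero at level \<open>i\<close>, i.e. it lies in the completed \<open>V \<otimes> \<mm>\<^sup>i\<close>.
\<close>

definition vanishing :: "('k::field \<Rightarrow> 'r::comm_ring_1) \<Rightarrow> ('k, 'v::ab_group_add, 'z) alg_coalg_scheme \<Rightarrow>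
    nat \<Rightarrow> ('k, 'v, 'r) ctens \<Rightarrow> bool" where
  "vanishing \<iota> V i x \<longleftrightarrow> (\<forall>h. adic_form \<iota> V i h \<longrightarrow> cpair i h x = 0)"

lemma vanishing_0: "vanishing \<iota> V 0 x"
  unfolding vanishing_def
proof (intro allI impI)
  fix h assume "adic_form \<iota> V 0 h"
  then have "h v r = 0" for v r by (rule adic_form_0)
  then show "cpair 0 h x = 0" by (simp add: cpair_def feval_fun_0)
qed

lemma vanishingD:
  assumes "vanishing \<iota> V i x" "x \<in> ctensor \<iota> V" "adic_form \<iota> V n h" "n \<le> i"
  shows "cpair n h x = 0"
proof -
  have i: "adic_form \<iota> V i h" by (rule adic_form_mono[OF assms(3,4)])
  show ?thesis
    using cpair_eq_level[OF assms(2,3) i] assms(1) i by (simp add: vanishing_def)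
qed

text \<open>
  This is \<open>\<mm>\<^sup>i \<mm>\<^sup>j \<subseteq> \<mm>\<^bsup>i+j\<^esup>\<close>. For fixed \<open>r \<in> \<mm>\<^sup>i\<close> the inner form kills \<open>\<mm>\<^sup>j\<close>, so it has level
  \<open>j\<close> and vanishes on \<open>y\<close>; hence the outer form has level \<open>i\<close> and vanishes on \<open>x\<close>.
\<close>

lemma cpair2_vanishing:
  assumes x: "x \<in> ctensor \<iota> V" "vanishing \<iota> V i x" and y: "y \<in> ctensor \<iota> V" "vanishing \<iota> V j y"
    and b: "adic_form2 \<iota> V n b" and n: "n \<le> i + j"
  shows "cpair2 n b x y = 0"
proof -
  let ?o = "\<lambda>v r. cpair n (\<lambda>w s. b v w (r * s)) y"
  have o: "adic_form \<iota> V n ?o" by (rule adic_form2_outer[OF b])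
  have "?o v r = 0" if r: "r \<in> max_ideal_pow i" for v r
  proof -
    have inner: "adic_form \<iota> V n (\<lambda>w s. b v w (r * s))" by (rule adic_form2_inner[OF b])
    have "b v w (r * s) = 0" if "s \<in> max_ideal_pow j" for w s
    proof -
      have "r * s \<in> max_ideal_pow n"
        using max_ideal_pow_mult[OF r that] max_ideal_pow_antimono[OF n] by blast
      then show ?thesis using b by (auto simp: adic_form2_def adic_form_def)
    qed
    then have "adic_form \<iota> V j (\<lambda>w s. b v w (r * s))"
      using inner by (simp add: adic_form_def)
    with cpair_eq_level[OF y(1) inner this] y(2) show ?thesis by (simp add: vanishing_def)
  qed
  then have "adic_form \<iota> V i ?o" using o by (simp add: adic_form_def)
  with cpair_eq_level[OF x(1) o this] x(2) show ?thesis by (simp add: vanishing_def cpair2_def)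
qed

lemma mul_simps:
  assumes "graded_comm_algebra V"
  shows "mul V (a + b) c = mul V a c + mul V b c" "mul V c (a + b) = mul V c a + mul V c b"
    "mul V (vscale V k a) c = vscale V k (mul V a c)" "mul V c (vscale V k a) = vscale V k (mul V c a)"
    "mul V (mul V a b) c = mul V a (mul V b c)" "mul V (unit V) a = a" "mul V a (unit V) = a"
proof -
  have *: "Vector_Spaces.linear (vscale V) (vscale V) (mul V c)"
    "Vector_Spaces.linear (vscale V) (vscale V) (\<lambda>a. mul V a c)" for c
    using assms by (simp_all add: graded_comm_algebra_def)
  show "mul V (a + b) c = mul V a c + mul V b c" "mul V (vscale V k a) c = vscale V k (mul V a c)"
    using *(2)[of c] by (simp_all add: Vector_Spaces.linear_iff)
  show "mul V c (a + b) = mul V c a + mul V c b" "mul V c (vscale V k a) = vscale V k (mul V c a)"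
    using *(1)[of c] by (simp_all add: Vector_Spaces.linear_iff)
  show "mul V (mul V a b) c = mul V a (mul V b c)" "mul V (unit V) a = a" "mul V a (unit V) = a"
    using assms by (simp_all add: graded_comm_algebra_def)
qed

lemma adic_form2_mul:
  assumes "graded_comm_algebra V" "adic_form \<iota> V n h"
  shows "adic_form2 \<iota> V n (\<lambda>v w t. h (mul V v w) t)"
  using adic_formD[OF assms(2)] unfolding adic_form2_def adic_form_def
  by (simp add: mul_simps[OF assms(1)])

lemma feval_fmul:
  "feval (\<lambda>p. h (fst p) (snd p)) (fmul V s t)
     = feval (\<lambda>p. feval (\<lambda>q. h (mul V (fst p) (fst q)) (snd p * snd q)) t) s"
  by (simp add: fmul_def feval_flin case_prod_beta)

lemma cpair_cmul:
  "adic_form \<iota> V n h \<Longrightarrow> cpair n h (cmul \<iota> V x y) = cpair2 n (\<lambda>v w t. h (mul V v w) t) x y"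
  by (subst cpair_level[of "cmul \<iota> V x y" n "fmul V (rep (x n)) (rep (y n))"])
     (auto simp: cmul_def feval_fmul cpair_def cpair2_def)

lemma cpair2_Suc:
  assumes "x \<in> ctensor \<iota> V" "y \<in> ctensor \<iota> V" "adic_form2 \<iota> V n b"
  shows "cpair2 (Suc n) b x y = cpair2 n b x y"
proof -
  have "cpair2 (Suc n) b x y = cpair (Suc n) (\<lambda>v r. cpair n (\<lambda>w s. b v w (r * s)) y) x"
    unfolding cpair2_def using cpair_Suc[OF assms(2) adic_form2_inner(1)[OF assms(3)]] by simp
  then show ?thesis
    unfolding cpair2_def using cpair_Suc[OF assms(1) adic_form2_outer[OF assms(3)]] by simp
qed

lemma cmul_in:
  assumes "graded_comm_algebra V" "x \<in> ctensor \<iota> V" "y \<in> ctensor \<iota> V"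
  shows "cmul \<iota> V x y \<in> ctensor \<iota> V"
proof (rule ctensorI[of _ "\<lambda>n. fmul V (rep (x n)) (rep (y n))"])
  fix n h assume "adic_form \<iota> V n h"
  then show "feval (\<lambda>p. h (fst p) (snd p)) (fmul V (rep (x (Suc n))) (rep (y (Suc n))))
      = feval (\<lambda>p. h (fst p) (snd p)) (fmul V (rep (x n)) (rep (y n)))"
    using cpair2_Suc[OF assms(2,3) adic_form2_mul[OF assms(1)]]
    by (simp add: feval_fmul cpair_def cpair2_def)
qed (simp add: cmul_def)

lemma cpow_in: "graded_comm_algebra V \<Longrightarrow> x \<in> ctensor \<iota> V \<Longrightarrow> cpow \<iota> V x k \<in> ctensor \<iota> V"
  by (induction k) (simp_all add: cone_in cmul_in)

lemma cmul_assoc: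
  assumes V: "graded_comm_algebra V" and xyz: "x \<in> ctensor \<iota> V" "y \<in> ctensor \<iota> V" "z \<in> ctensor \<iota> V"
  shows "cmul \<iota> V (cmul \<iota> V x y) z = cmul \<iota> V x (cmul \<iota> V y z)"
proof (rule ctensor_eqI)
  show "cmul \<iota> V (cmul \<iota> V x y) z \<in> ctensor \<iota> V" "cmul \<iota> V x (cmul \<iota> V y z) \<in> ctensor \<iota> V"
    using xyz by (simp_all add: cmul_in V)
  fix n h assume h: "adic_form \<iota> V n h"
  note f2 = adic_form2_mul[OF V h]
  show "cpair n h (cmul \<iota> V (cmul \<iota> V x y) z) = cpair n h (cmul \<iota> V x (cmul \<iota> V y z))"
    unfolding cpair_cmul[OF h] unfolding cpair2_def
    unfolding cpair_cmul[OF adic_form2_outer[OF f2]] cpair_cmul[OF adic_form2_inner(1)[OF f2]]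
    by (simp add: cpair2_def mul_simps[OF V] mult.assoc)
qed

lemma cmul_cone:
  assumes V: "graded_comm_algebra V" and x: "x \<in> ctensor \<iota> V"
  shows "cmul \<iota> V (cone \<iota> V) x = x" "cmul \<iota> V x (cone \<iota> V) = x"
proof -
  have "cpair n h (cmul \<iota> V (cone \<iota> V) x) = cpair n h x" "cpair n h (cmul \<iota> V x (cone \<iota> V)) = cpair n h x"
    if h: "adic_form \<iota> V n h" for n h
    unfolding cpair_cmul[OF h] using cpair_cone[OF adic_form2_outer[OF adic_form2_mul[OF V h]]]
      cpair_cone[OF adic_form2_inner(1)[OF adic_form2_mul[OF V h]]]
    by (simp_all add: cpair2_def mul_simps[OF V])
  then show "cmul \<iota> V (cone \<iota> V) x = x" "cmul \<iota> V x (cone \<iota> V) = x"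
    using ctensor_eqI x cmul_in[OF V] cone_in by metis+
qed

lemma cpow_add:
  assumes V: "graded_comm_algebra V" and x: "x \<in> ctensor \<iota> V"
  shows "cmul \<iota> V (cpow \<iota> V x i) (cpow \<iota> V x j) = cpow \<iota> V x (i + j)"
proof (induction i)
  case 0
  then show ?case by (simp add: cmul_cone V x cpow_in)
next
  case (Suc i)
  have "cmul \<iota> V (cpow \<iota> V x (Suc i)) (cpow \<iota> V x j)
      = cmul \<iota> V x (cmul \<iota> V (cpow \<iota> V x i) (cpow \<iota> V x j))"
    by (simp add: cmul_assoc V x cpow_in)
  then show ?case by (simp add: Suc)
qed

text \<open>
  This makes the exponential and logarithm series of \<open>x\<close> finite at every level.
\<close>

lemma vanishing_cpow:
  assumes V: "graded_comm_algebra V" and x: "x \<in> ctensor \<iota> V" "vanishing \<iota> V 1 x"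
  shows "vanishing \<iota> V k (cpow \<iota> V x k)"
proof (induction k)
  case 0
  then show ?case by (simp add: vanishing_0)
next
  case (Suc k)
  show ?case
    unfolding vanishing_def
  proof (intro allI impI)
    fix h assume h: "adic_form \<iota> V (Suc k) h"
    show "cpair (Suc k) h (cpow \<iota> V x (Suc k)) = 0"
      using cpair2_vanishing[OF x cpow_in[OF V x(1)] Suc adic_form2_mul[OF V h]]
      by (simp add: cpair_cmul[OF h])
  qed
qed


section \<open>Power series in an element divisible by the maximal ideal\<close>

lemma csum_in: "(\<And>k. X k \<in> ctensor \<iota> V) \<Longrightarrow> csum \<iota> V X K \<in> ctensor \<iota> V"
  by (induction K) (simp_all add: czero_in cadd_in)

lemma cpair_csum:
  assumes "\<And>k. X k \<in> ctensor \<iota> V" "adic_form \<iota> V n h"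
  shows "cpair n h (csum \<iota> V X K) = (\<Sum>k<K. cpair n h (X k))"
  by (induction K) (simp_all add: cpair_czero[OF assms(2)] cpair_cadd[OF csum_in assms(1) assms(2)] assms(1))

text \<open>
  The terms of index at least \<open>n\<close> are zero at level \<open>n\<close>, so the partial sums are constant there from
  the \<open>n\<close>-th on and their diagonal is the limit.
\<close>

lemma cseries_props:
  assumes X: "\<And>k. X k \<in> ctensor \<iota> V" and van: "\<And>k. vanishing \<iota> V k (X k)"
  shows "cseries \<iota> V X \<in> ctensor \<iota> V"
    and "adic_form \<iota> V n h \<Longrightarrow> cpair n h (cseries \<iota> V X) = (\<Sum>k<n. cpair n h (X k))"
proof -
  define L where "L n = csum \<iota> V X n n" for n
  have Lrep: "L n = rep (csum \<iota> V X n n) +o adic \<iota> V n" for n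
    unfolding L_def by (rule ctensor_rep[OF csum_in[OF X]])
  have zero: "cpair n h (X k) = 0" if "adic_form \<iota> V n h" "n \<le> k" for n h k
    by (rule vanishingD[OF van X that])
  have L: "L \<in> ctensor \<iota> V"
  proof (rule ctensorI[of _ "\<lambda>n. rep (csum \<iota> V X n n)", OF Lrep])
    fix n h assume h: "adic_form \<iota> V n h"
    have h': "adic_form \<iota> V (Suc n) h" by (rule adic_form_mono[OF h]) simp
    have "cpair (Suc n) h (csum \<iota> V X (Suc n)) = cpair n h (csum \<iota> V X n)"
      unfolding cpair_csum[OF X h] cpair_csum[OF X h']
      using cpair_Suc[OF X h] zero[OF h] by simp
    then show "feval (\<lambda>p. h (fst p) (snd p)) (rep (csum \<iota> V X (Suc n) (Suc n)))
        = feval (\<lambda>p. h (fst p) (snd p)) (rep (csum \<iota> V X n n))"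
      by (simp only: cpair_def)
  qed
  have conv: "cconverges (csum \<iota> V X) L"
    unfolding cconverges_def
  proof (intro allI exI impI)
    fix n k :: nat assume "n \<le> k"
    show "csum \<iota> V X k n = L n"
      unfolding L_def
    proof (rule ctensor_level_eqI[OF csum_in[OF X] csum_in[OF X]])
      fix h assume h: "adic_form \<iota> V n h"
      have "(\<Sum>i<n. cpair n h (X i)) = (\<Sum>i<k. cpair n h (X i))"
        using \<open>n \<le> k\<close> zero[OF h] by (intro sum.mono_neutral_left) auto
      then show "cpair n h (csum \<iota> V X k) = cpair n h (csum \<iota> V X n)"
        by (simp add: cpair_csum[OF X h])
    qed
  qed
  have unique: "y = L" if lim: "cconverges (csum \<iota> V X) y" for y
  proof
    fix n
    obtain N where N: "\<forall>k\<ge>N. csum \<iota> V X k n = y n"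
      using lim unfolding cconverges_def by blast
    obtain M where "\<forall>k\<ge>M. csum \<iota> V X k n = L n"
      using conv unfolding cconverges_def by blast
 with N show "y n = L n" by (metis nat_le_linear)
  qed
  have eq: "cseries \<iota> V X = L"
    unfolding cseries_def
  proof (rule the_equality)
    show "L \<in> ctensor \<iota> V \<and> cconverges (csum \<iota> V X) L" using L conv ..
  qed (rule unique, erule conjunct2)
  show "cseries \<iota> V X \<in> ctensor \<iota> V" using L eq by simp
  assume h: "adic_form \<iota> V n h"
  have "cpair n h L = cpair n h (csum \<iota> V X n)"
    by (simp add: cpair_def L_def)
  then show "cpair n h (cseries \<iota> V X) = (\<Sum>k<n. cpair n h (X k))"
    by (simp add: eq cpair_csum[OF X h])
qed

text \<open>
  The power series \<open>p\<close> evaluated at \<open>x\<close> is \<open>y\<close>. Only the terms below \<open>n\<close> appear at level \<open>n\<close>, which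
  is correct for \<open>x\<close> in the completed tensor product with \<open>\<mm>\<close>. For such \<open>x\<close> evaluation is a ring homomorphism
  defined on all formal power series, and identities between series can be quoted from there.
\<close>

definition series_value :: "('k::field_char_0 \<Rightarrow> 'r::comm_ring_1) \<Rightarrow>
    ('k, 'v::ab_group_add, 'z) alg_coalg_scheme \<Rightarrow> ('k, 'v, 'r) ctens \<Rightarrow> 'k fps \<Rightarrow> ('k, 'v, 'r) ctens \<Rightarrow> bool" where
  "series_value \<iota> V x p y \<longleftrightarrow> y \<in> ctensor \<iota> V \<and> (\<forall>n h. adic_form \<iota> V n h \<longrightarrow>
     cpair n h y = (\<Sum>k<n. fps_nth p k * cpair n h (cpow \<iota> V x k)))"

lemma sum_square_eq_triangle:
  fixes F :: "nat \<Rightarrow> nat \<Rightarrow> 'a::comm_monoid_add"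
  assumes "\<And>i j. n \<le> i + j \<Longrightarrow> F i j = 0"
  shows "(\<Sum>i<n. \<Sum>j<n. F i j) = (\<Sum>k<n. \<Sum>i\<le>k. F i (k - i))"
proof -
  have "(\<Sum>i<n. \<Sum>j<n. F i j) = (\<Sum>(i, j)\<in>{..<n} \<times> {..<n}. F i j)"
    by (simp add: sum.cartesian_product)
  also have "\<dots> = (\<Sum>(i, j)\<in>{(i, j). i + j < n}. F i j)"
  proof (intro sum.mono_neutral_right ballI)
    fix p assume "p \<in> {..<n} \<times> {..<n} - {(i, j). i + j < n}"
    then show "(case p of (i, j) \<Rightarrow> F i j) = 0"
      using assms by (cases p) simp
  qed auto
  finally show ?thesis by (simp add: sum.triangle_reindex)
qed

lemma series_value_unique:
  "series_value \<iota> V x p y \<Longrightarrow> series_value \<iota> V x p z \<Longrightarrow> y = z"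
  by (rule ctensor_eqI[of y \<iota> V z]) (simp_all add: series_value_def)

text \<open>
  The composite of the logarithm series with \<open>e\<^sup>X - 1\<close> is \<open>X\<close>; as \<open>e\<^sup>X - 1\<close> has no constant term, its
  powers above the \<open>l\<close>-th do not contribute to the coefficient of \<open>X\<^sup>l\<close>, so any \<open>n > l\<close> terms suffice.
\<close>

lemma fps_ln_compose_exp:
  assumes "l < n"
  shows "(\<Sum>k<n. (- 1) ^ k / of_nat (Suc k) * fps_nth ((fps_exp 1 - 1) ^ Suc k) l)
    = fps_nth (fps_X :: 'k::field_char_0 fps) l"
proof -
  let ?E = "fps_exp 1 - 1 :: 'k fps"
  have E: "fps_nth ?E 0 = 0" "fps_nth ?E 1 \<noteq> 0" by simp_all
  have "fps_nth fps_X l = fps_nth (fps_ln 1 oo ?E) l"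
    by (simp only: fps_ln_fps_exp_inv[of 1] one_neq_zero not_False_eq_True fps_inv[OF E])
  also have "\<dots> = (\<Sum>i\<le>l. fps_nth (fps_ln 1) i * fps_nth (?E ^ i) l)"
    by (simp add: fps_compose_nth atLeast0AtMost)
  also have "\<dots> = (\<Sum>i<Suc n. fps_nth (fps_ln 1) i * fps_nth (?E ^ i) l)"
    using assms startsby_zero_power_prefix[OF E(1)] by (intro sum.mono_neutral_left) auto
  also have "\<dots> = (\<Sum>k<n. (- 1) ^ k / of_nat (Suc k) * fps_nth (?E ^ Suc k) l)"
    by (subst sum.lessThan_Suc_shift) (simp add: fps_ln_nth del: of_nat_Suc power_Suc)
  finally show ?thesis by simp
qed

context
  fixes \<iota> :: "'k::field_char_0 \<Rightarrow> 'r::comm_ring_1"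
    and V :: "('k, 'v::ab_group_add, 'z) alg_coalg_scheme" and x :: "('k, 'v, 'r) ctens"
  assumes V: "graded_comm_algebra V" and x: "x \<in> ctensor \<iota> V" and x1: "vanishing \<iota> V 1 x"
begin

lemma series_value_exp: "series_value \<iota> V x (fps_exp 1) (cexp \<iota> V x)"
proof -
  let ?X = "\<lambda>n. cscale \<iota> V (\<iota> (1 / fact n)) (cpow \<iota> V x n)"
  have X: "?X k \<in> ctensor \<iota> V" for k by (simp add: cscale_in cpow_in V x)
  have van: "vanishing \<iota> V k (?X k)" for k
    using vanishing_cpow[OF V x x1, of k] by (simp add: vanishing_def cpair_cscale_const)
  show ?thesis
    using cseries_props[of ?X, OF X van] by (simp add: series_value_def cexp_def cpair_cscale_const)
qed

lemma series_value_one: "series_value \<iota> V x 1 (cone \<iota> V)"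
  unfolding series_value_def
proof (intro conjI allI impI)
  fix n h assume h: "adic_form \<iota> V n h"
  show "cpair n h (cone \<iota> V) = (\<Sum>k<n. fps_nth 1 k * cpair n h (cpow \<iota> V x k))"
  proof (cases n)
    case 0
    then show ?thesis using h vanishing_0[of \<iota> V "cone \<iota> V"] by (simp add: vanishing_def)
  next
    case (Suc m)
    then show ?thesis by (simp add: mult_delta_left)
  qed
qed (rule cone_in)

lemma series_value_X: "series_value \<iota> V x fps_X x"
  unfolding series_value_def
proof (intro conjI allI impI)
  fix n h assume h: "adic_form \<iota> V n h"
  have "(\<Sum>k<n. fps_nth fps_X k * cpair n h (cpow \<iota> V x k)) = (if 1 < n then cpair n h x else 0)"
    by (simp add: fps_X_def mult_delta_left cmul_cone V x)
  moreover have "cpair n h x = 0" if "\<not> 1 < n"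
    by (rule vanishingD[OF x1 x h]) (use that in simp)
  ultimately show "cpair n h x = (\<Sum>k<n. fps_nth fps_X k * cpair n h (cpow \<iota> V x k))"
    by simp
qed (rule x)

lemma series_value_minus_one:
  assumes "series_value \<iota> V x p y"
  shows "series_value \<iota> V x (p - 1) (cadd y (cscale \<iota> V (- 1) (cone \<iota> V)))"
  unfolding series_value_def
proof (intro conjI allI impI)
  have y: "y \<in> ctensor \<iota> V" using assms by (simp add: series_value_def)
  show "cadd y (cscale \<iota> V (- 1) (cone \<iota> V)) \<in> ctensor \<iota> V"
    by (intro cadd_in cscale_in cone_in y)
  fix n h assume h: "adic_form \<iota> V n h"
  have "h (unit V) (- 1) = - h (unit V) 1"
    using adic_formD(2)[OF h, of "unit V" 1 "- 1"] adic_form_zero(2)[OF h] by (simp add: eq_neg_iff_add_eq_0 add.commute)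
  then have "cpair n h (cscale \<iota> V (- 1) (cone \<iota> V)) = - cpair n h (cone \<iota> V)"
    unfolding cpair_cscale[OF h] cpair_cone[OF h] cpair_cone[OF adic_form_scale[OF h]] by simp
  then show "cpair n h (cadd y (cscale \<iota> V (- 1) (cone \<iota> V)))
      = (\<Sum>k<n. fps_nth (p - 1) k * cpair n h (cpow \<iota> V x k))"
    using assms series_value_one h
    by (simp add: cpair_cadd[OF y cscale_in[OF cone_in] h] series_value_def left_diff_distrib sum_subtractf)
qed

lemma series_value_mult:
  assumes y: "series_value \<iota> V x p y" and z: "series_value \<iota> V x q z"
  shows "series_value \<iota> V x (p * q) (cmul \<iota> V y z)"
  unfolding series_value_def
proof (intro conjI allI impI)
  have yz: "y \<in> ctensor \<iota> V" "z \<in> ctensor \<iota> V" using y z by (simp_all add: series_value_def)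
  show "cmul \<iota> V y z \<in> ctensor \<iota> V" by (rule cmul_in[OF V yz])
  fix n h assume h: "adic_form \<iota> V n h"
  let ?b = "\<lambda>v w t. h (mul V v w) t"
  let ?P = "\<lambda>k. cpair n h (cpow \<iota> V x k)"
  note b = adic_form2_mul[OF V h]
  have "cpair n h (cmul \<iota> V y z)
      = (\<Sum>j<n. fps_nth q j * cpair n (\<lambda>w s. cpair n (\<lambda>v r. ?b v w (r * s)) y) (cpow \<iota> V x j))"
    unfolding cpair_cmul[OF h] cpair2_swap
    using z adic_form2_outer'[OF b] by (simp add: series_value_def)
  also have "\<dots> = (\<Sum>j<n. fps_nth q j * cpair n (\<lambda>v r. cpair n (\<lambda>w s. ?b v w (r * s)) (cpow \<iota> V x j)) y)"
    by (subst cpair_swap) simp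
  also have "\<dots> = (\<Sum>j<n. fps_nth q j * (\<Sum>i<n. fps_nth p i * cpair2 n ?b (cpow \<iota> V x i) (cpow \<iota> V x j)))"
    using y adic_form2_outer[OF b] by (simp add: series_value_def cpair2_def)
  also have "\<dots> = (\<Sum>j<n. \<Sum>i<n. fps_nth p i * fps_nth q j * ?P (i + j))"
    by (simp add: cpair_cmul[OF h, symmetric] cpow_add[OF V x] sum_distrib_left mult_ac)
  also have "\<dots> = (\<Sum>i<n. \<Sum>j<n. fps_nth p i * fps_nth q j * ?P (i + j))"
    by (rule sum.swap)
  also have "\<dots> = (\<Sum>k<n. \<Sum>i\<le>k. fps_nth p i * fps_nth q (k - i) * ?P (i + (k - i)))"
    using vanishingD[OF vanishing_cpow[OF V x x1] cpow_in[OF V x] h]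
    by (intro sum_square_eq_triangle) simp
  also have "\<dots> = (\<Sum>k<n. fps_nth (p * q) k * ?P k)"
    by (simp add: fps_mult_nth sum_distrib_right atLeast0AtMost)
  finally show "cpair n h (cmul \<iota> V y z) = (\<Sum>k<n. fps_nth (p * q) k * ?P k)" .
qed

lemma series_value_cpow:
  assumes "series_value \<iota> V x p y"
  shows "series_value \<iota> V x (p ^ j) (cpow \<iota> V y j)"
  by (induction j) (simp_all add: series_value_one series_value_mult assms)

text \<open>
  Both sides are values of power series at \<open>x\<close>, and the two series coincide.
\<close>

lemma clog_cexp: "clog \<iota> V (cexp \<iota> V x) = x"
proof -
  let ?E = "fps_exp 1 - 1 :: 'k fps"
  define y where "y = cadd (cexp \<iota> V x) (cscale \<iota> V (- 1) (cone \<iota> V))"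
  have y: "series_value \<iota> V x ?E y"
    unfolding y_def by (rule series_value_minus_one[OF series_value_exp])
  then have yin: "y \<in> ctensor \<iota> V" by (simp add: series_value_def)
  have y1: "vanishing \<iota> V 1 y" using y by (simp add: series_value_def vanishing_def)
  let ?X = "\<lambda>n. cscale \<iota> V (\<iota> ((- 1) ^ n / of_nat (Suc n))) (cpow \<iota> V y (Suc n))"
  have X: "?X k \<in> ctensor \<iota> V" for k by (intro cscale_in cpow_in V yin)
  have van: "vanishing \<iota> V k (?X k)" for k
  proof -
    have "cpair k h (cpow \<iota> V y (Suc k)) = 0" if "adic_form \<iota> V k h" for h
      by (rule vanishingD[OF vanishing_cpow[OF V yin y1] cpow_in[OF V yin] that]) simp
    then show ?thesis by (simp add: vanishing_def cpair_cscale_const del: cpow.simps)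
  qed
  have "series_value \<iota> V x fps_X (cseries \<iota> V ?X)"
    unfolding series_value_def
  proof (intro conjI allI impI)
    show "cseries \<iota> V ?X \<in> ctensor \<iota> V" by (rule cseries_props(1)[OF X van])
    fix n h assume h: "adic_form \<iota> V n h"
    let ?P = "\<lambda>k. cpair n h (cpow \<iota> V x k)"
    have "cpair n h (cseries \<iota> V ?X)
        = (\<Sum>k<n. (- 1) ^ k / of_nat (Suc k) * cpair n h (cpow \<iota> V y (Suc k)))"
      using cseries_props(2)[of ?X, OF X van h] by (simp only: cpair_cscale_const[OF h])
    also have "\<dots> = (\<Sum>k<n. (- 1) ^ k / of_nat (Suc k) * (\<Sum>l<n. fps_nth (?E ^ Suc k) l * ?P l))"
      using series_value_cpow[OF y, of "Suc _"] h by (simp only: series_value_def)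
    also have "\<dots> = (\<Sum>l<n. (\<Sum>k<n. (- 1) ^ k / of_nat (Suc k) * fps_nth (?E ^ Suc k) l) * ?P l)"
      unfolding sum_distrib_left sum_distrib_right mult.assoc by (rule sum.swap)
    also have "\<dots> = (\<Sum>l<n. fps_nth fps_X l * ?P l)"
      by (intro sum.cong refl) (simp only: fps_ln_compose_exp lessThan_iff)
    finally show "cpair n h (cseries \<iota> V ?X) = (\<Sum>l<n. fps_nth fps_X l * ?P l)" .
  qed
  then have "cseries \<iota> V ?X = x"
    by (rule series_value_unique[OF _ series_value_X])
  then show ?thesis by (simp only: clog_def Let_def y_def)
qed

end


section \<open>Bilinear forms and the comultiplication\<close>

definition bilin :: "('k::field, 'v::ab_group_add, 'z) alg_coalg_scheme \<Rightarrow> ('v \<Rightarrow> 'v \<Rightarrow> 'k) \<Rightarrow> bool" where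
  "bilin V b \<longleftrightarrow> (\<forall>u v w. b (u + v) w = b u w + b v w) \<and> (\<forall>u v w. b w (u + v) = b w u + b w v) \<and>
     (\<forall>c u w. b (vscale V c u) w = c * b u w) \<and> (\<forall>c u w. b w (vscale V c u) = c * b w u)"

lemma bilinD:
  assumes "bilin V b"
  shows "b (u + v) w = b u w + b v w" "b w (u + v) = b w u + b w v"
    "b (vscale V c u) w = c * b u w" "b w (vscale V c u) = c * b w u"
  using assms by (simp_all add: bilin_def)

lemma bilin_zero: "bilin V b \<Longrightarrow> b 0 w = 0" "bilin V b \<Longrightarrow> b w 0 = 0"
  using bilinD(1)[of V b 0 0 w] bilinD(2)[of V b w 0 0]
  by (simp_all only: add_0 add_cancel_right_right)

lemma bilin_sum_right: "bilin V b \<Longrightarrow> b w (\<Sum>i\<in>I. u i) = (\<Sum>i\<in>I. b w (u i))"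
  by (induction I rule: infinite_finite_induct) (simp_all add: bilin_zero bilinD)

definition on_pairs :: "('v \<Rightarrow> 'v \<Rightarrow> 'k::field) \<Rightarrow> 'v list \<Rightarrow> 'k" where
  "on_pairs b xs = (case xs of [u, v] \<Rightarrow> b u v | _ \<Rightarrow> 0)"

text \<open>
  The value of the bilinear form \<open>b\<close> on an element of \<open>V \<otimes> V\<close>, computed on a representative;
  lists of length other than two are ignored, as in the convolution product.
\<close>

definition tpair :: "('v \<Rightarrow> 'v \<Rightarrow> 'k::field) \<Rightarrow> ('v list \<Rightarrow>\<^sub>0 'k) set \<Rightarrow> 'k" where
  "tpair b A = feval (on_pairs b) (rep A)"

lemma on_pairs_pair [simp]: "on_pairs b [u, v] = b u v"
  by (simp add: on_pairs_def)

lemma on_pairs_append: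
  "on_pairs b (xs @ u # ys) =
     (case (xs, ys) of ([], [y]) \<Rightarrow> b u y | ([x], []) \<Rightarrow> b x u | _ \<Rightarrow> 0)"
  unfolding on_pairs_def by (auto split: list.splits simp: append_eq_Cons_conv)

lemma tpair_coset:
  assumes "bilin V b" "A = t +o multilin_rel V"
  shows "tpair b A = feval (on_pairs b) t"
proof -
  let ?G = "{gen (xs @ (u + v) # ys) - gen (xs @ u # ys) - gen (xs @ v # ys) | xs u v ys. True} \<union>
      {gen (xs @ vscale V c v # ys) - fscale c (gen (xs @ v # ys)) | xs c v ys. True}"
  have "\<forall>g\<in>?G. feval (on_pairs b) g = 0"
    by (intro ballI; elim UnE CollectE exE conjE)
       (simp_all add: feval_diff feval_fscale on_pairs_append bilinD[OF assms(1)] split: list.splits)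
  moreover have "rep A \<in> t +o fspan ?G"
    unfolding assms(2) multilin_rel_def by (rule rep_in[OF self_in_coset])
  ultimately show ?thesis unfolding tpair_def by (rule feval_coset)
qed

lemma tpair_fun_add: "tpair (\<lambda>u v. b u v + b' u v) A = tpair b A + tpair b' A"
proof -
  have "on_pairs (\<lambda>u v. b u v + b' u v) = (\<lambda>xs. on_pairs b xs + on_pairs b' xs)"
    by (auto simp: on_pairs_def split: list.splits)
  then show ?thesis by (simp add: tpair_def feval_fun_add)
qed

lemma tpair_fun_cmult: "tpair (\<lambda>u v. c * b u v) A = c * tpair b A"
proof -
  have "on_pairs (\<lambda>u v. c * b u v) = (\<lambda>xs. c * on_pairs b xs)"
    by (auto simp: on_pairs_def split: list.splits)
  then show ?thesis by (simp add: tpair_def feval_fun_cmult)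
qed

lemma on_pairs_0: "on_pairs (\<lambda>u v. 0) = (\<lambda>xs. 0)"
  by (auto simp: on_pairs_def split: list.splits)

lemma tpair_fun_0 [simp]: "tpair (\<lambda>u v. 0) A = 0"
  by (simp add: tpair_def on_pairs_0 feval_fun_0)

lemma tpair_cpair_swap:
  "cpair n (\<lambda>v r. tpair (\<lambda>c d. b c d v r) A) x = tpair (\<lambda>c d. cpair n (\<lambda>v r. b c d v r) x) A"
proof -
  have "on_pairs (\<lambda>c d. cpair n (\<lambda>v r. b c d v r) x)
      = (\<lambda>xs. cpair n (\<lambda>v r. on_pairs (\<lambda>c d. b c d v r) xs) x)"
    by (auto simp: on_pairs_def split: list.splits)
  then show ?thesis by (simp add: tpair_def cpair_feval_swap)
qed

lemma comul_coset:
  assumes "graded_cocomm_coalgebra V"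
  shows "comul V v = rep (comul V v) +o multilin_rel V"
proof -
  have "comul V v \<in> tensor_power V 2" using assms by (simp add: graded_cocomm_coalgebra_def)
  then obtain t where t: "comul V v = t +o multilin_rel V" unfolding tensor_power_def by blast
  obtain G where G: "multilin_rel V = fspan G" unfolding multilin_rel_def by blast
  have "rep (comul V v) \<in> t +o fspan G"
    unfolding t G by (rule rep_in[OF self_in_coset])
  then show ?thesis
    unfolding t G by (auto simp: coset_eq_iff mem_coset_iff mem_fspan_iff feval_diff)
qed

lemma tpair_comul_add:
  assumes "graded_cocomm_coalgebra V" "bilin V b"
  shows "tpair b (comul V (u + v)) = tpair b (comul V u) + tpair b (comul V v)"
proof -
  have "comul V (u + v) = comul V u + comul V v" using assms by (simp add: graded_cocomm_coalgebra_def)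
  also have "\<dots> = (rep (comul V u) + rep (comul V v)) +o multilin_rel V"
  proof -
    obtain G where G: "multilin_rel V = fspan G" unfolding multilin_rel_def by blast
    show ?thesis
      unfolding G coset_add[symmetric]
      using comul_coset[OF assms(1), of u] comul_coset[OF assms(1), of v] G by simp
  qed
  finally show ?thesis
    using tpair_coset[OF assms(2)] by (simp add: feval_add tpair_def)
qed

lemma tpair_comul_scale:
  assumes "graded_cocomm_coalgebra V" "bilin V b"
  shows "tpair b (comul V (vscale V c v)) = c * tpair b (comul V v)"
proof -
  have "comul V (vscale V c v) = fscale c (rep (comul V v)) +o multilin_rel V"
    using assms by (simp add: graded_cocomm_coalgebra_def)
  then show ?thesis
    using tpair_coset[OF assms(2)] by (simp add: feval_fscale tpair_def)
qed

lemma tpair_primitive: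
  assumes "bilin V b" "v \<in> primitives V"
  shows "tpair b (comul V v) = b v (unit V) + b (unit V) v"
  using assms(2) tpair_coset[OF assms(1)] by (simp add: primitives_def feval_add)

text \<open>
  Evaluate \<open>\<epsilon> \<otimes> \<epsilon>\<close> on \<open>\<delta>(v)\<close>: the counit axiom gives \<open>\<epsilon>(v)\<close> and primitivity gives \<open>2 \<epsilon>(v)\<close>.
\<close>

lemma counit_primitive:
  assumes V: "graded_cocomm_coalgebra V" "counit V (unit V) = 1" and v: "v \<in> primitives V"
  shows "counit V v = 0"
proof -
  let ?b = "\<lambda>u v. counit V u * counit V v"
  have lin: "counit V (u + v) = counit V u + counit V v" "counit V (vscale V c u) = c * counit V u" for u v c
    using V(1) by (simp_all add: graded_cocomm_coalgebra_def Vector_Spaces.linear_iff)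
  have b: "bilin V ?b" by (simp add: bilin_def lin algebra_simps)
  let ?one = "\<lambda>xs. case xs of [u] \<Rightarrow> counit V u | _ \<Rightarrow> 0"
  let ?\<epsilon> = "\<lambda>v. fscale (counit V v) (gen [])"
  have ev: "feval ?one (apply_at ?\<epsilon> 0 t) = feval (on_pairs ?b) t" for t
    unfolding apply_at_def feval_flin
    by (intro feval_cong) (auto simp: feval_flin feval_fscale on_pairs_def split: list.splits)
  have "teq V (apply_at ?\<epsilon> 0 (rep (comul V v))) (gen [v])"
    using V(1) by (simp add: graded_cocomm_coalgebra_def Let_def)
  moreover have van: "feval ?one s = 0" if "s \<in> multilin_rel V" for s
  proof -
    let ?G = "{gen (xs @ (u + v) # ys) - gen (xs @ u # ys) - gen (xs @ v # ys) | xs u v ys. True} \<union>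
      {gen (xs @ vscale V c v # ys) - fscale c (gen (xs @ v # ys)) | xs c v ys. True}"
    have app: "?one (xs @ u # ys) = (if xs = [] \<and> ys = [] then counit V u else 0)" for xs u ys
      by (auto split: list.splits simp: append_eq_Cons_conv)
    have "\<forall>g\<in>?G. feval ?one g = 0"
      by (intro ballI; elim UnE CollectE exE conjE)
         (simp_all only: feval_diff feval_fscale feval_gen app lin, simp_all)
    then show ?thesis using that unfolding multilin_rel_def mem_fspan_iff by blast
  qed
  ultimately have "feval ?one (apply_at ?\<epsilon> 0 (rep (comul V v))) = feval ?one (gen [v])"
    unfolding teq_def using van by (metis (no_types, lifting) feval_diff eq_iff_diff_eq_0)
  then have "tpair ?b (comul V v) = counit V v"
    unfolding ev tpair_def by simp
  then have "counit V v = counit V v + counit V v"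
    using tpair_primitive[OF b v] by (simp only: V(2) mult_1_left mult_1_right)
  then show ?thesis by (simp only: add_cancel_right_right)
qed


section \<open>Koszul signs\<close>

text \<open>
  The form \<open>b\<close> with Koszul signs inserted between the homogeneous components of its arguments. It describes
  the sign that the product of \<open>V \<otimes> V\<close> produces when its two inner factors pass each other.
\<close>

definition braided :: "('k::field, 'v::ab_group_add, 'z) alg_coalg_scheme \<Rightarrow> ('v \<Rightarrow> 'v \<Rightarrow> 'k) \<Rightarrow> 'v \<Rightarrow> 'v \<Rightarrow> 'k" where
  "braided V b u v = (\<Sum>p\<in>hsupp V u. \<Sum>q\<in>hsupp V v. ksign p q * b (hcomp V u p) (hcomp V v q))"

lemma braided_fun_add: "braided V (\<lambda>u v. b u v + b' u v) u v = braided V b u v + braided V b' u v"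
  by (simp add: braided_def distrib_left sum.distrib)

lemma braided_fun_cmult: "braided V (\<lambda>u v. c * b u v) u v = c * braided V b u v"
  by (simp add: braided_def sum_distrib_left mult.left_commute)

lemma braided_fun_0: "braided V (\<lambda>u v. 0) u v = 0"
  by (simp add: braided_def)

lemma hcomp_outside: "i \<notin> hsupp V v \<Longrightarrow> hcomp V v i = 0"
  by (simp add: hsupp_def)

lemma is_decompI:
  assumes "\<And>i. c i \<in> grading V i" "finite A" "\<And>i. i \<notin> A \<Longrightarrow> c i = 0" "(\<Sum>i\<in>A. c i) = v"
  shows "is_decomp V v c"
proof -
  have sub: "{i. c i \<noteq> 0} \<subseteq> A" using assms(3) by blast
  have "(\<Sum>i | c i \<noteq> 0. c i) = (\<Sum>i\<in>A. c i)"
    using assms(2) sub by (intro sum.mono_neutral_left) auto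
  then show ?thesis
    using assms finite_subset[OF sub] by (simp add: is_decomp_def)
qed

context
  fixes V :: "('k::field, 'v::ab_group_add, 'z) alg_coalg_scheme"
  assumes V: "graded_space V"
begin

lemma is_decomp_hcomp: "is_decomp V v (hcomp V v)"
  unfolding hcomp_def by (rule theI'[of "is_decomp V v"]) (use V in \<open>simp add: graded_space_def\<close>)

lemma hcomp_eqI: "is_decomp V v c \<Longrightarrow> hcomp V v = c"
  using V is_decomp_hcomp[of v] unfolding graded_space_def by blast

lemma finite_hsupp: "finite (hsupp V v)"
  using is_decomp_hcomp[of v] by (simp add: is_decomp_def hsupp_def)

lemma sum_hcomp: "finite A \<Longrightarrow> hsupp V v \<subseteq> A \<Longrightarrow> (\<Sum>i\<in>A. hcomp V v i) = v"
proof -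
  assume A: "finite A" "hsupp V v \<subseteq> A"
  have "(\<Sum>i\<in>A. hcomp V v i) = (\<Sum>i\<in>hsupp V v. hcomp V v i)"
    using A by (intro sum.mono_neutral_right) (auto simp: hsupp_def)
  then show ?thesis using is_decomp_hcomp[of v] by (simp add: is_decomp_def hsupp_def)
qed

lemma hcomp_add: "hcomp V (u + v) = (\<lambda>i. hcomp V u i + hcomp V v i)"
proof (rule hcomp_eqI)
  interpret vs: vector_space "vscale V" using V by (simp add: graded_space_def)
  let ?A = "hsupp V u \<union> hsupp V v"
  show "is_decomp V (u + v) (\<lambda>i. hcomp V u i + hcomp V v i)"
  proof (rule is_decompI[where A = ?A])
    show "hcomp V u i + hcomp V v i \<in> grading V i" for i
      using V is_decomp_hcomp[of u] is_decomp_hcomp[of v]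
      by (simp add: graded_space_def is_decomp_def vs.subspace_add)
  qed (auto simp: finite_hsupp sum.distrib sum_hcomp hcomp_outside)
qed

lemma hcomp_scale: "hcomp V (vscale V c v) = (\<lambda>i. vscale V c (hcomp V v i))"
proof (rule hcomp_eqI)
  interpret vs: vector_space "vscale V" using V by (simp add: graded_space_def)
  show "is_decomp V (vscale V c v) (\<lambda>i. vscale V c (hcomp V v i))"
  proof (rule is_decompI[where A = "hsupp V v"])
    show "vscale V c (hcomp V v i) \<in> grading V i" for i
      using V is_decomp_hcomp[of v] by (simp add: graded_space_def is_decomp_def vs.subspace_scale)
  qed (auto simp: finite_hsupp sum_hcomp hcomp_outside vs.scale_sum_right[symmetric])
qed

lemma hcomp_homogeneous:
  assumes "v \<in> grading V p" shows "hcomp V v = (\<lambda>i. if i = p then v else 0)"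
proof (rule hcomp_eqI)
  interpret vs: vector_space "vscale V" using V by (simp add: graded_space_def)
  show "is_decomp V v (\<lambda>i. if i = p then v else 0)"
  proof (rule is_decompI[where A = "{p}"])
    show "(if i = p then v else 0) \<in> grading V i" for i
      using V assms by (simp add: graded_space_def vs.subspace_0)
  qed auto
qed

lemma braided_superset:
  assumes "bilin V b" "finite A" "hsupp V u \<subseteq> A" "finite B" "hsupp V v \<subseteq> B"
  shows "braided V b u v = (\<Sum>p\<in>A. \<Sum>q\<in>B. ksign p q * b (hcomp V u p) (hcomp V v q))"
proof -
  have "braided V b u v = (\<Sum>p\<in>hsupp V u. \<Sum>q\<in>B. ksign p q * b (hcomp V u p) (hcomp V v q))"
    unfolding braided_def using assms
    by (intro sum.cong refl sum.mono_neutral_left) (auto simp: hsupp_def bilin_zero)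
  also have "\<dots> = (\<Sum>p\<in>A. \<Sum>q\<in>B. ksign p q * b (hcomp V u p) (hcomp V v q))"
    using assms by (intro sum.mono_neutral_left) (auto simp: hsupp_def bilin_zero)
  finally show ?thesis .
qed

lemma hsupp_add: "hsupp V (u + v) \<subseteq> hsupp V u \<union> hsupp V v"
  by (auto simp: hsupp_def hcomp_add)

lemma hsupp_scale: "hsupp V (vscale V c v) \<subseteq> hsupp V v"
proof -
  interpret vs: vector_space "vscale V" using V by (simp add: graded_space_def)
  show ?thesis by (auto simp: hsupp_def hcomp_scale)
qed

lemma braided_add:
  assumes "bilin V b" shows "braided V b (u + u') v = braided V b u v + braided V b u' v"
proof -
  let ?A = "hsupp V u \<union> hsupp V u'"
  show ?thesis
    using braided_superset[OF assms, of ?A _ "hsupp V v" v] hsupp_add[of u u']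
    by (simp add: finite_hsupp hcomp_add bilinD[OF assms] distrib_left sum.distrib)
qed

lemma braided_scale:
  assumes "bilin V b" shows "braided V b (vscale V c u) v = c * braided V b u v"
  using braided_superset[OF assms, of "hsupp V u" _ "hsupp V v" v] hsupp_scale[of c u]
  by (simp add: finite_hsupp hcomp_scale bilinD[OF assms] sum_distrib_left mult.left_commute)

text \<open>
  Elements of degree \<open>0\<close> move without signs past every other element.
\<close>

lemma braided_degree_0:
  assumes b: "bilin V b" and u: "u \<in> grading V 0"
  shows "braided V b u v = b u v"
proof -
  have "braided V b u v = (\<Sum>p\<in>{0}. \<Sum>q\<in>hsupp V v. ksign p q * b (hcomp V u p) (hcomp V v q))"
    by (rule braided_superset[OF b]) (auto simp: finite_hsupp hsupp_def[of V u] hcomp_homogeneous[OF u])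
  also have "\<dots> = b u (\<Sum>q\<in>hsupp V v. hcomp V v q)"
    by (simp add: hcomp_homogeneous[OF u] ksign_def bilin_sum_right[OF b])
  finally show ?thesis by (simp add: sum_hcomp finite_hsupp)
qed

end

lemma feval_tmul2:
  "feval (on_pairs b) (tmul2 V s t) = feval (on_pairs (\<lambda>u v. feval (on_pairs (\<lambda>c d.
     \<Sum>p\<in>hsupp V v. \<Sum>q\<in>hsupp V c. ksign p q * b (mul V u (hcomp V c q)) (mul V (hcomp V v p) d))) t)) s"
proof -
  let ?T = "\<lambda>u v c d. \<Sum>p\<in>hsupp V v. \<Sum>q\<in>hsupp V c.
    ksign p q * b (mul V u (hcomp V c q)) (mul V (hcomp V v p) d)"
  have "feval (on_pairs b) (case (xs, ys) of
       ([a, b], [c, d]) \<Rightarrow> (\<Sum>p\<in>hsupp V b. \<Sum>q\<in>hsupp V c.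
          fscale (ksign p q) (gen [mul V a (hcomp V c q), mul V (hcomp V b p) d]))
     | _ \<Rightarrow> 0) = on_pairs (\<lambda>u v. on_pairs (?T u v) ys) xs" for xs ys
    by (auto simp: on_pairs_def feval_sum feval_fscale split: list.splits)
  moreover have "feval (\<lambda>ys. on_pairs (\<lambda>u v. on_pairs (?T u v) ys) xs) t
      = on_pairs (\<lambda>u v. feval (on_pairs (?T u v)) t) xs" for xs
  proof (cases "\<exists>u v. xs = [u, v]")
    case False
    then have "on_pairs f xs = 0" for f :: "'b \<Rightarrow> 'b \<Rightarrow> 'a" by (auto simp: on_pairs_def split: list.splits)
    then show ?thesis by (simp add: feval_fun_0)
  qed auto
  ultimately show ?thesis
    by (simp add: tmul2_def feval_flin)
qed


section \<open>The exponential of a primitive element is group-like\<close>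

text \<open>
  The value of the form \<open>b\<close> on \<open>\<delta>(x)\<close>, where \<open>\<delta>\<close> is extended \<open>R\<close>-linearly.
\<close>

definition coev :: "('k::field, 'v::ab_group_add, 'z) alg_coalg_scheme \<Rightarrow> nat \<Rightarrow>
    ('v \<Rightarrow> 'v \<Rightarrow> 'r::comm_ring_1 \<Rightarrow> 'k) \<Rightarrow> ('k, 'v, 'r) ctens \<Rightarrow> 'k" where
  "coev V n b x = cpair n (\<lambda>v r. tpair (\<lambda>c d. b c d r) (comul V v)) x"

lemma adic_form2_bilin: "adic_form2 \<iota> V n b \<Longrightarrow> bilin V (\<lambda>c d. b c d t)"
  by (simp add: adic_form2_def adic_form_def bilin_def)

lemma adic_form2D:
  assumes "adic_form2 \<iota> V n b"
  shows "b (u + v) w t = b u w t + b v w t" "b w (u + v) t = b w u t + b w v t"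
    "b (vscale V c u) w t = c * b u w t" "b w (vscale V c u) t = c * b w u t"
    "b u w (s + t) = b u w s + b u w t" "b u w (\<iota> c * t) = c * b u w t"
    "t \<in> max_ideal_pow n \<Longrightarrow> b u w t = 0"
  using assms by (simp_all add: adic_form2_def adic_form_def)

lemma adic_form_tpair:
  assumes "graded_cocomm_coalgebra V" "adic_form2 \<iota> V n b"
  shows "adic_form \<iota> V n (\<lambda>v r. tpair (\<lambda>c d. b c d r) (comul V v))"
  unfolding adic_form_def
  by (simp add: adic_form2D[OF assms(2)] tpair_fun_add tpair_fun_cmult
      tpair_comul_add[OF assms(1) adic_form2_bilin[OF assms(2)]]
      tpair_comul_scale[OF assms(1) adic_form2_bilin[OF assms(2)]])

lemma bilin_mul_right:
  "graded_comm_algebra V \<Longrightarrow> bilin V b \<Longrightarrow> bilin V (\<lambda>y z. b (mul V u z) (mul V y d))"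
  by (simp add: bilin_def mul_simps)

lemma tpair_comul_mul:
  assumes V: "graded_comm_algebra V" "graded_cocomm_coalgebra V" "bialgebra_compatible V"
    and b: "bilin V b"
  shows "tpair b (comul V (mul V v w)) = tpair (\<lambda>x y. tpair (\<lambda>c d.
    braided V (\<lambda>y z. b (mul V x z) (mul V y d)) y c) (comul V w)) (comul V v)"
proof -
  have gs: "graded_space V" using V by (simp add: graded_comm_algebra_def)
  obtain G where G: "multilin_rel V = fspan G" unfolding multilin_rel_def by blast
  have "rep (comul V (mul V v w)) - tmul2 V (rep (comul V v)) (rep (comul V w)) \<in> fspan G"
    using V(3) by (simp add: bialgebra_compatible_def teq_def G)
  then have "rep (comul V (mul V v w)) +o fspan G = tmul2 V (rep (comul V v)) (rep (comul V w)) +o fspan G"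
    by (simp add: coset_eq_iff)
  then have "comul V (mul V v w) = tmul2 V (rep (comul V v)) (rep (comul V w)) +o multilin_rel V"
    using comul_coset[OF V(2), of "mul V v w"] G by simp
  from tpair_coset[OF b this] show ?thesis
    by (simp add: feval_tmul2 tpair_def braided_def)
qed

text \<open>
  This is \<open>\<delta>(v w) = (v \<otimes> 1 + 1 \<otimes> v) \<delta>(w)\<close>. The left factor \<open>v \<otimes> 1\<close> gives no sign, since the
  unit has degree \<open>0\<close>; in \<open>1 \<otimes> v\<close> the element \<open>v\<close> has to pass the first factor of \<open>\<delta>(w)\<close>.
\<close>

lemma tpair_comul_primitive_mul:
  assumes V: "graded_comm_algebra V" "graded_cocomm_coalgebra V" "bialgebra_compatible V"
    and b: "bilin V b" and v: "v \<in> primitives V"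
  shows "tpair b (comul V (mul V v w)) = tpair (\<lambda>c d. b (mul V v c) d +
    braided V (\<lambda>y z. b z (mul V y d)) v c) (comul V w)"
proof -
  have gs: "graded_space V" using V by (simp add: graded_comm_algebra_def)
  let ?o = "\<lambda>x y. tpair (\<lambda>c d. braided V (\<lambda>y z. b (mul V x z) (mul V y d)) y c) (comul V w)"
  have "bilin V ?o"
    using bilin_mul_right[OF V(1) b]
    by (simp add: bilin_def[of V ?o] bilinD[OF b] mul_simps[OF V(1)] braided_fun_add
        braided_fun_cmult braided_add[OF gs] braided_scale[OF gs] tpair_fun_add tpair_fun_cmult)
  from tpair_primitive[OF this v] have "tpair b (comul V (mul V v w)) = ?o v (unit V) + ?o (unit V) v"
    unfolding tpair_comul_mul[OF V b] .
  moreover have "unit V \<in> grading V 0" using V(1) by (simp add: graded_comm_algebra_def)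
  ultimately show ?thesis
    by (simp add: braided_degree_0[OF gs bilin_mul_right[OF V(1) b]] mul_simps[OF V(1)] tpair_fun_add)
qed

text \<open>
  The form \<open>b\<close> composed with multiplication by \<open>S \<otimes> 1 + 1 \<otimes> S\<close>, where \<open>S\<close> has degree \<open>0\<close>.
\<close>

definition coproduct_form :: "('k::field, 'v::ab_group_add, 'z) alg_coalg_scheme \<Rightarrow> nat \<Rightarrow>
    ('k, 'v, 'r::comm_ring_1) ctens \<Rightarrow> ('v \<Rightarrow> 'v \<Rightarrow> 'r \<Rightarrow> 'k) \<Rightarrow> ('v \<Rightarrow> 'v \<Rightarrow> 'r \<Rightarrow> 'k)" where
  "coproduct_form V n S b = (\<lambda>c d t. cpair n (\<lambda>v r. b (mul V v c) d (r * t) + b c (mul V v d) (r * t)) S)"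

lemma adic_form2_coproduct_form:
  assumes "graded_comm_algebra V" "adic_form2 \<iota> V n b"
  shows "adic_form2 \<iota> V n (coproduct_form V n S b)"
  unfolding coproduct_form_def adic_form2_def adic_form_def
  by (simp add: mul_simps[OF assms(1)] adic_form2D[OF assms(2)] cpair_fun_add cpair_fun_cmult
      distrib_left mult.left_commute[of _ "\<iota> _"] max_ideal_pow_mult_left)

lemma cpair2_coproduct_form:
  assumes V: "graded_comm_algebra V" and b: "adic_form2 \<iota> V n b"
  shows "cpair2 n (coproduct_form V n S b) x y = cpair2 n b (cmul \<iota> V S x) y + cpair2 n b x (cmul \<iota> V S y)"
proof -
  have "cpair2 n b (cmul \<iota> V S x) y
      = cpair n (\<lambda>v r. cpair n (\<lambda>c r'. cpair n (\<lambda>d s. b (mul V v c) d (r * r' * s)) y) x) S"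
    using cpair_cmul[OF adic_form2_outer[OF b]] by (simp add: cpair2_def)
  also have "\<dots> = cpair n (\<lambda>c r'. cpair n (\<lambda>v r. cpair n (\<lambda>d s. b (mul V v c) d (r * r' * s)) y) S) x"
    by (rule cpair_swap)
  also have "\<dots> = cpair n (\<lambda>c r'. cpair n (\<lambda>d s. cpair n (\<lambda>v r. b (mul V v c) d (r * r' * s)) S) y) x"
    by (subst cpair_swap) simp
  finally have 1: "cpair2 n b (cmul \<iota> V S x) y = \<dots>" .
  have "cpair2 n b x (cmul \<iota> V S y)
      = cpair n (\<lambda>c r'. cpair n (\<lambda>v r. cpair n (\<lambda>d s. b c (mul V v d) (r' * (r * s))) y) S) x"
    using cpair_cmul[OF adic_form2_inner(1)[OF b]] by (simp add: cpair2_def)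
  also have "\<dots> = cpair n (\<lambda>c r'. cpair n (\<lambda>d s. cpair n (\<lambda>v r. b c (mul V v d) (r' * (r * s))) S) y) x"
    by (subst cpair_swap) simp
  finally have 2: "cpair2 n b x (cmul \<iota> V S y) = \<dots>" .
  show ?thesis
    unfolding 1 2
    by (simp add: cpair2_def coproduct_form_def cpair_fun_add mult.assoc mult.left_commute)
qed

text \<open>
  A finite combination of forms in \<open>(v, r)\<close> is again one;
  this lets the integrand of \<open>coev\<close> be modified by any family that is a form in that pair.
\<close>

lemma adic_form_family:
  assumes "\<And>c d. adic_form \<iota> V n (\<lambda>v t. g v c d t)"
  shows "adic_form \<iota> V n (\<lambda>v r. cpair n (\<lambda>w s. tpair (\<lambda>c d. g v c d (r * s)) (comul V w)) z)"
proof -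
  have "adic_form \<iota> V n (\<lambda>v r. g v c d (r * s))" for c d s
    using adic_form_scale[OF assms, where r = s] by (simp add: mult.commute)
  note D = adic_formD[OF this]
  show ?thesis
    unfolding adic_form_def
    by (simp add: D tpair_fun_add tpair_fun_cmult cpair_fun_add cpair_fun_cmult)
qed

lemma csub_rep:
  assumes "x \<in> csub \<iota> V P"
  obtains a where "Poly_Mapping.keys a \<subseteq> P \<times> UNIV" "x n = a +o adic \<iota> V n"
  using assms unfolding csub_def by blast

lemma csub_subset_ctensor: "x \<in> csub \<iota> V P \<Longrightarrow> x \<in> ctensor \<iota> V"
  unfolding ctensor_def csub_def by blast

text \<open>
  At level \<open>n\<close> an element of the completed \<open>P \<otimes> R\<close> has a representative supported on \<open>P\<close>, so two forms that
  agree on \<open>P\<close> have the same value. That both are forms on all of \<open>V\<close> matters: it makes the values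
  independent of the representative, and so the lemma can be applied successively with different \<open>P\<close>.
\<close>

lemma cpair_csub_cong:
  assumes x: "x \<in> csub \<iota> V P" and h: "adic_form \<iota> V n h" "adic_form \<iota> V n h'"
    and eq: "\<And>v r. v \<in> P \<Longrightarrow> h v r = h' v r"
  shows "cpair n h x = cpair n h' x"
proof -
  obtain a where a: "Poly_Mapping.keys a \<subseteq> P \<times> UNIV" "x n = a +o adic \<iota> V n"
    by (rule csub_rep[OF x])
  show ?thesis
    unfolding cpair_level[of x n, OF a(2) h(1)] cpair_level[of x n, OF a(2) h(2)]
    using a(1) eq by (intro feval_cong) auto
qed

text \<open>
  This is \<open>\<delta>(S z) = (S \<otimes> 1 + 1 \<otimes> S) \<delta>(z)\<close>. Primitivity of \<open>S\<close> and its degree are used one after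
  the other, each on its own representative of \<open>S\<close>. The first step needs the sign in \<open>g1\<close>, because the
  primitive elements in a representative need not have degree \<open>0\<close>; the second step removes it.
\<close>

lemma coev_cmul:
  assumes V: "graded_comm_algebra V" "graded_cocomm_coalgebra V" "bialgebra_compatible V"
    and S: "S \<in> csub \<iota> V (primitives V)" "S \<in> csub \<iota> V (grading V 0)"
    and b: "adic_form2 \<iota> V n b"
  shows "coev V n b (cmul \<iota> V S z) = coev V n (coproduct_form V n S b) z"
proof -
  have gs: "graded_space V" using V by (simp add: graded_comm_algebra_def)
  note bb = adic_form2_bilin[OF b]
  define g1 where "g1 v c d t = b (mul V v c) d t + braided V (\<lambda>y x. b x (mul V y d) t) v c" for v c d t
  define g2 where "g2 v c d t = b (mul V v c) d t + b c (mul V v d) t" for v c d t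
  \<comment> \<open>The value of \<open>b\<close> on \<open>\<delta>(S z)\<close> is a form in \<open>S\<close>; \<open>h1\<close> agrees with it on primitive elements, and \<open>h2\<close> with \<open>h1\<close> in degree \<open>0\<close>.\<close>
  define h0 where "h0 v r = cpair n (\<lambda>w s. tpair (\<lambda>c d. b c d (r * s)) (comul V (mul V v w))) z" for v r
  define h1 where "h1 v r = cpair n (\<lambda>w s. tpair (\<lambda>c d. g1 v c d (r * s)) (comul V w)) z" for v r
  define h2 where "h2 v r = cpair n (\<lambda>w s. tpair (\<lambda>c d. g2 v c d (r * s)) (comul V w)) z" for v r
  have bil: "bilin V (\<lambda>y x. b x (mul V y d) t)" for d t
    using bb by (simp add: bilin_def mul_simps[OF V(1)])
  have g1: "adic_form \<iota> V n (\<lambda>v t. g1 v c d t)" for c d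
    unfolding g1_def adic_form_def
    by (simp add: adic_form2D[OF b] mul_simps[OF V(1)] braided_fun_add braided_fun_0
        braided_fun_cmult braided_add[OF gs bil] braided_scale[OF gs bil] distrib_left)
  have g2: "adic_form \<iota> V n (\<lambda>v t. g2 v c d t)" for c d
    unfolding g2_def adic_form_def
    by (simp add: adic_form2D[OF b] mul_simps[OF V(1)] distrib_left)
  note a0 = adic_form2_outer[OF adic_form2_mul[OF V(1) adic_form_tpair[OF V(2) b]], of z, folded h0_def]
  note a1 = adic_form_family[of \<iota> V n g1, OF g1, of z, folded h1_def]
  note a2 = adic_form_family[of \<iota> V n g2, OF g2, of z, folded h2_def]
  have "coev V n b (cmul \<iota> V S z) = cpair n h0 S"
    by (simp add: coev_def cpair_cmul[OF adic_form_tpair[OF V(2) b]] cpair2_def h0_def[abs_def])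
  also have "\<dots> = cpair n h1 S"
    by (rule cpair_csub_cong[OF S(1) a0 a1])
       (simp add: h0_def h1_def g1_def tpair_comul_primitive_mul[OF V bb])
  also have "\<dots> = cpair n h2 S"
    by (rule cpair_csub_cong[OF S(2) a1 a2])
       (simp add: h1_def h2_def g1_def g2_def braided_degree_0[OF gs bil])
  also have "\<dots> = cpair n (\<lambda>w s. cpair n (\<lambda>v r. tpair (\<lambda>c d. g2 v c d (r * s)) (comul V w)) S) z"
    unfolding h2_def by (rule cpair_swap)
  also have "\<dots> = coev V n (coproduct_form V n S b) z"
    by (simp add: coev_def coproduct_form_def g2_def tpair_cpair_swap)
  finally show ?thesis .
qed

text \<open>
  The inductive step of the binomial theorem, for a function \<open>G\<close> of the two exponents instead of a product of
  powers.
\<close>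

lemma pascal_sum:
  fixes G :: "nat \<Rightarrow> nat \<Rightarrow> 'a::comm_semiring_1"
  shows "(\<Sum>i\<le>k. of_nat (k choose i) * (G (Suc i) (k - i) + G i (Suc (k - i))))
    = (\<Sum>i\<le>Suc k. of_nat (Suc k choose i) * G i (Suc k - i))"
proof -
  have "(\<Sum>i\<le>k. of_nat (k choose i) * G i (Suc (k - i))) = (\<Sum>i\<le>Suc k. of_nat (k choose i) * G i (Suc k - i))"
    by (simp add: Suc_diff_le binomial_eq_0)
  also have "\<dots> = G 0 (Suc k) + (\<Sum>i\<le>k. of_nat (k choose Suc i) * G (Suc i) (k - i))"
    by (subst sum.atMost_Suc_shift) simp
  finally show ?thesis
    unfolding sum.atMost_Suc_shift by (simp add: distrib_left distrib_right sum.distrib add_ac)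
qed

context
  fixes \<iota> :: "'k::field_char_0 \<Rightarrow> 'r::comm_ring_1"
    and V :: "('k, 'v::ab_group_add, 'z) alg_coalg_scheme" and S :: "('k, 'v, 'r) ctens"
  assumes V: "graded_comm_algebra V" "graded_cocomm_coalgebra V" "bialgebra_compatible V"
    and one: "comul V (unit V) = gen [unit V, unit V] +o multilin_rel V"
    and S: "S \<in> csub \<iota> V (primitives V)" "S \<in> csub \<iota> V (grading V 0)" "vanishing \<iota> V 1 S"
begin

lemma S_in: "S \<in> ctensor \<iota> V"
  by (rule csub_subset_ctensor[OF S(1)])

text \<open>
  The binomial formula \<open>\<delta>(S\<^sup>k) = \<Sum> binom(k, i) S\<^sup>i \<otimes> S\<^bsup>k-i\<^esup>\<close>. The form has to vary in the induction, as each
  factor \<open>S\<close> replaces it by its \<open>coproduct_form\<close>.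
\<close>

lemma coev_cpow:
  assumes "adic_form2 \<iota> V n b"
  shows "coev V n b (cpow \<iota> V S k)
    = (\<Sum>i\<le>k. of_nat (k choose i) * cpair2 n b (cpow \<iota> V S i) (cpow \<iota> V S (k - i)))"
  using assms
proof (induction k arbitrary: b)
  case 0
  note b = adic_form2_bilin[OF 0]
  have "coev V n b (cone \<iota> V) = tpair (\<lambda>c d. b c d 1) (comul V (unit V))"
    unfolding coev_def by (rule cpair_cone[OF adic_form_tpair[OF V(2) 0]])
  also have "\<dots> = b (unit V) (unit V) 1"
    by (simp add: tpair_coset[OF b one])
  also have "\<dots> = cpair2 n b (cone \<iota> V) (cone \<iota> V)"
    using cpair_cone[OF adic_form2_outer[OF 0], of "cone \<iota> V"]
      cpair_cone[OF adic_form2_inner(1)[OF 0], of "unit V" 1] by (simp add: cpair2_def)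
  finally show ?case by simp
next
  case (Suc k)
  let ?Q = "\<lambda>i j. cpair2 n b (cpow \<iota> V S i) (cpow \<iota> V S j)"
  have "coev V n b (cpow \<iota> V S (Suc k)) = coev V n (coproduct_form V n S b) (cpow \<iota> V S k)"
    using coev_cmul[OF V S(1,2) Suc.prems] by simp
  also have "\<dots> = (\<Sum>i\<le>k. of_nat (k choose i) * (?Q (Suc i) (k - i) + ?Q i (Suc (k - i))))"
    using cpair2_coproduct_form[OF V(1) Suc.prems]
    by (simp add: Suc.IH[OF adic_form2_coproduct_form[OF V(1) Suc.prems]])
  also have "\<dots> = (\<Sum>i\<le>Suc k. of_nat (Suc k choose i) * ?Q i (Suc k - i))"
    by (rule pascal_sum)
  finally show ?case .
qed

lemma cpair_cexp:
  "adic_form \<iota> V n h \<Longrightarrow> cpair n h (cexp \<iota> V S) = (\<Sum>k<n. 1 / fact k * cpair n h (cpow \<iota> V S k))"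
  using series_value_exp[OF V(1) S_in S(3)] by (simp add: series_value_def)

lemma cexp_in: "cexp \<iota> V S \<in> ctensor \<iota> V"
  using series_value_exp[OF V(1) S_in S(3)] by (simp add: series_value_def)

text \<open>
  This is \<open>\<delta>(e\<^sup>S) = e\<^sup>S \<otimes> e\<^sup>S\<close>. At level \<open>n\<close> the left side is the sum over \<open>i + j < n\<close> of
  \<open>S\<^sup>i \<otimes> S\<^sup>j / (i! j!)\<close> and the right side the sum over \<open>i, j < n\<close>; the additional terms lie in \<open>\<mm>\<^sup>n\<close>.
\<close>

lemma cexp_grouplike:
  assumes b: "adic_form2 \<iota> V n b"
  shows "coev V n b (cexp \<iota> V S) = cpair2 n b (cexp \<iota> V S) (cexp \<iota> V S)"
proof -
  let ?E = "cexp \<iota> V S"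
  let ?Q = "\<lambda>i j. cpair2 n b (cpow \<iota> V S i) (cpow \<iota> V S j)"
  have "coev V n b ?E = (\<Sum>k<n. 1 / fact k * coev V n b (cpow \<iota> V S k))"
    unfolding coev_def by (rule cpair_cexp[OF adic_form_tpair[OF V(2) b]])
  also have "\<dots> = (\<Sum>k<n. \<Sum>i\<le>k. ?Q i (k - i) / (fact i * fact (k - i)))"
    by (intro sum.cong refl)
       (simp add: coev_cpow[OF b] sum_distrib_left binomial_fact sum_divide_distrib)
  also have "\<dots> = (\<Sum>i<n. \<Sum>j<n. ?Q i j / (fact i * fact j))"
    using cpair2_vanishing[OF cpow_in[OF V(1) S_in] vanishing_cpow[OF V(1) S_in S(3)]
        cpow_in[OF V(1) S_in] vanishing_cpow[OF V(1) S_in S(3)] b]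
    by (intro sum_square_eq_triangle[symmetric]) simp
  also have "\<dots> = (\<Sum>i<n. 1 / fact i * cpair n (\<lambda>v r. cpair n (\<lambda>w s. b v w (r * s)) ?E) (cpow \<iota> V S i))"
    unfolding cpair_cexp[OF adic_form2_inner(1)[OF b]]
    by (simp add: cpair2_def cpair_fun_sum cpair_fun_cmult[of n "1 / _", simplified] sum_distrib_left sum_divide_distrib)
  also have "\<dots> = cpair2 n b ?E ?E"
    unfolding cpair2_def by (rule cpair_cexp[OF adic_form2_outer[OF b], symmetric])
  finally show ?thesis .
qed

end


section \<open>Continuous linear maps\<close>

text \<open>
  Linearity of a map \<open>\<phi>\<close> from \<open>V\<close> to the completed tensor product of \<open>W\<close> and \<open>R\<close>, tested by forms.
\<close>

definition linear_family :: "('k::field \<Rightarrow> 'r::comm_ring_1) \<Rightarrow> ('k, 'v::ab_group_add, 'y) alg_coalg_scheme \<Rightarrow>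
    ('k, 'w::ab_group_add, 'z) alg_coalg_scheme \<Rightarrow> ('v \<Rightarrow> ('k, 'w, 'r) ctens) \<Rightarrow> bool" where
  "linear_family \<iota> V W \<phi> \<longleftrightarrow> (\<forall>v. \<phi> v \<in> ctensor \<iota> W) \<and>
     (\<forall>n h. adic_form \<iota> W n h \<longrightarrow>
       (\<forall>u v. cpair n h (\<phi> (u + v)) = cpair n h (\<phi> u) + cpair n h (\<phi> v)) \<and>
       (\<forall>c v. cpair n h (\<phi> (vscale V c v)) = c * cpair n h (\<phi> v)))"

lemma linear_familyD:
  assumes "linear_family \<iota> V W \<phi>"
  shows "\<phi> v \<in> ctensor \<iota> W"
    and "adic_form \<iota> W n h \<Longrightarrow> cpair n h (\<phi> (u + v)) = cpair n h (\<phi> u) + cpair n h (\<phi> v)"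
    and "adic_form \<iota> W n h \<Longrightarrow> cpair n h (\<phi> (vscale V c v)) = c * cpair n h (\<phi> v)"
  using assms by (simp_all add: linear_family_def)

text \<open>
  The map \<open>f\<close> is the continuous \<open>R\<close>-linear extension of \<open>v \<mapsto> f(v \<otimes> 1)\<close>. In this form the property is
  inherited by convolution products.
\<close>

definition extends_linearly :: "('k::field \<Rightarrow> 'r::comm_ring_1) \<Rightarrow> ('k, 'v::ab_group_add, 'y) alg_coalg_scheme \<Rightarrow>
    ('k, 'w::ab_group_add, 'z) alg_coalg_scheme \<Rightarrow> (('k, 'v, 'r) ctens \<Rightarrow> ('k, 'w, 'r) ctens) \<Rightarrow> bool" where
  "extends_linearly \<iota> V W f \<longleftrightarrow> (\<forall>x\<in>ctensor \<iota> V. f x \<in> ctensor \<iota> W) \<and>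
     linear_family \<iota> V W (\<lambda>v. f (cpure \<iota> V v 1)) \<and>
     (\<forall>n h. adic_form \<iota> W n h \<longrightarrow> (\<forall>x\<in>ctensor \<iota> V.
        cpair n h (f x) = cpair n (\<lambda>v r. cpair n (\<lambda>w s. h w (r * s)) (f (cpure \<iota> V v 1))) x))"

lemma extends_linearlyD:
  assumes "extends_linearly \<iota> V W f"
  shows "x \<in> ctensor \<iota> V \<Longrightarrow> f x \<in> ctensor \<iota> W"
    and "linear_family \<iota> V W (\<lambda>v. f (cpure \<iota> V v 1))"
    and "adic_form \<iota> W n h \<Longrightarrow> x \<in> ctensor \<iota> V \<Longrightarrow>
      cpair n h (f x) = cpair n (\<lambda>v r. cpair n (\<lambda>w s. h w (r * s)) (f (cpure \<iota> V v 1))) x"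
  using assms by (simp_all add: extends_linearly_def)

lemma adic_form_pullback:
  assumes \<phi>: "linear_family \<iota> V W \<phi>" and h: "adic_form \<iota> W n h"
  shows "adic_form \<iota> V n (\<lambda>v r. cpair n (\<lambda>w s. h w (r * s)) (\<phi> v))"
proof -
  have kill: "h w (r * s) = 0" if "r \<in> max_ideal_pow n" for w r s
    using adic_formD(5)[OF h max_ideal_pow_mult_left[OF that, of s]] by (simp add: mult.commute)
  show ?thesis
    unfolding adic_form_def
    by (simp add: linear_familyD(2,3)[OF \<phi> adic_form_scale[OF h]] adic_formD(2,4)[OF h] distrib_right
        mult.assoc cpair_fun_add cpair_fun_cmult kill)
qed

lemma cpair_cext:
  assumes "adic_form \<iota> W n h"
  shows "cpair n h (cext \<iota> W \<phi> x) = cpair n (\<lambda>v r. cpair n (\<lambda>w s. h w (r * s)) (\<phi> v)) x"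
  by (subst cpair_level[of "cext \<iota> W \<phi> x" n "flin (\<lambda>(v, r). rmul r (rep (\<phi> v n))) (rep (x n))"])
     (auto simp: assms cext_def cpair_def feval_flin feval_rmul case_prod_beta)

lemma extends_linearly_cext:
  fixes \<phi> :: "'v::ab_group_add \<Rightarrow> ('k::field, 'w::ab_group_add, 'r::comm_ring_1) ctens"
  assumes \<phi>: "linear_family \<iota> V W \<phi>"
  shows "extends_linearly \<iota> V W (cext \<iota> W \<phi>)"
proof -
  note pull = adic_form_pullback[OF \<phi>]
  have inn: "cext \<iota> W \<phi> x \<in> ctensor \<iota> W" if x: "x \<in> ctensor \<iota> V" for x
  proof (rule ctensorI[of _ "\<lambda>n. flin (\<lambda>(v, r). rmul r (rep (\<phi> v n))) (rep (x n))"])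
    fix n h assume h: "adic_form \<iota> W n h"
    have "cpair (Suc n) (\<lambda>v r. cpair (Suc n) (\<lambda>w s. h w (r * s)) (\<phi> v)) x
        = cpair n (\<lambda>v r. cpair n (\<lambda>w s. h w (r * s)) (\<phi> v)) x"
      unfolding cpair_Suc[OF linear_familyD(1)[OF \<phi>] adic_form_scale[OF h]] by (rule cpair_Suc[OF x pull[OF h]])
    then show "feval (\<lambda>p. h (fst p) (snd p)) (flin (\<lambda>(v, r). rmul r (rep (\<phi> v (Suc n)))) (rep (x (Suc n))))
      = feval (\<lambda>p. h (fst p) (snd p)) (flin (\<lambda>(v, r). rmul r (rep (\<phi> v n))) (rep (x n)))"
      by (simp add: cpair_def feval_flin feval_rmul case_prod_beta)
  qed (simp add: cext_def)
  have pure: "cext \<iota> W \<phi> (cpure \<iota> V v 1) = \<phi> v" for v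
  proof (rule ctensor_eqI[OF inn[OF cpure_in] linear_familyD(1)[OF \<phi>]])
    fix n h assume h: "adic_form \<iota> W n h"
    show "cpair n h (cext \<iota> W \<phi> (cpure \<iota> V v 1)) = cpair n h (\<phi> v)"
      unfolding cpair_cext[OF h] cpair_cpure[OF pull[OF h]] by simp
  qed
  show ?thesis
    unfolding extends_linearly_def using inn \<phi> by (simp add: pure cpair_cext)
qed

lemma cadd_cpure_eq:
  "cadd (cpure \<iota> V u 1) (cpure \<iota> V v 1) = cpure \<iota> V (u + v) 1"
  by (rule ctensor_eqI[of _ \<iota> V])
     (simp_all add: cpure_in cadd_in cpair_cadd[OF cpure_in cpure_in] cpair_cpure adic_formD)

lemma cscale_cpure_eq:
  "cscale \<iota> V (\<iota> c) (cpure \<iota> V v 1) = cpure \<iota> V (vscale V c v) 1"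
  by (rule ctensor_eqI[of _ \<iota> V])
     (simp_all add: cpure_in cscale_in cpair_cscale_const cpair_cpure adic_formD)

text \<open>
  Induction over the ways to build a formal combination; zero is a scalar multiple of a generator.
\<close>

lemma formal_combination_induct [case_names scaled add]:
  fixes P :: "('x \<Rightarrow>\<^sub>0 'k::field) \<Rightarrow> bool"
  assumes "\<And>c x. P (fscale c (gen x))" and "\<And>s t. P s \<Longrightarrow> P t \<Longrightarrow> P (s + t)"
  shows "P t"
proof -
  have P0: "P 0"
  proof -
    have "fscale 0 (gen x) = (0 :: 'x \<Rightarrow>\<^sub>0 'k)" for x
      by (rule poly_mapping_eqI) (simp add: lookup_fscale)
    then show ?thesis using assms(1)[of 0] by metis
  qed
  have "P (\<Sum>x\<in>A. fscale (Poly_Mapping.lookup t x) (gen x))" if "finite A" for A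
    using that by (induction A) (simp_all add: assms P0)
  from this[of "Poly_Mapping.keys t"] show ?thesis
    using formal_combination_expand[of t] by simp
qed

text \<open>
  Continuity alone gives, for each \<open>n\<close>, some level \<open>m\<close> that determines \<open>f\<close> at level \<open>n\<close>. A finite
  representative of \<open>x\<close> at level \<open>m\<close> then has the same image at level \<open>n\<close>, and on finite combinations \<open>f\<close> is
  computed by \<open>R\<close>-linearity. A posteriori the value is that of a form of level \<open>n\<close>, whence the larger of the
  two levels serves to compare.
\<close>

lemma extends_linearly_cont_lin:
  assumes f: "f \<in> cont_lin_deg \<iota> V W d"
  shows "extends_linearly \<iota> V W f"
proof -
  have f_in: "\<And>x. x \<in> ctensor \<iota> V \<Longrightarrow> f x \<in> ctensor \<iota> W"
    and f_add: "\<And>x y. x \<in> ctensor \<iota> V \<Longrightarrow> y \<in> ctensor \<iota> V \<Longrightarrow> f (cadd x y) = cadd (f x) (f y)"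
    and f_scale: "\<And>r x. x \<in> ctensor \<iota> V \<Longrightarrow> f (cscale \<iota> V r x) = cscale \<iota> W r (f x)"
    and f_cont: "\<And>n. \<exists>m. \<forall>x\<in>ctensor \<iota> V. \<forall>y\<in>ctensor \<iota> V. x m = y m \<longrightarrow> f x n = f y n"
    using f by (simp_all add: cont_lin_deg_def)
  let ?\<phi> = "\<lambda>v. f (cpure \<iota> V v 1)"
  have lin: "cpair n h (?\<phi> (u + v)) = cpair n h (?\<phi> u) + cpair n h (?\<phi> v)"
    "cpair n h (?\<phi> (vscale V c v)) = c * cpair n h (?\<phi> v)" if h: "adic_form \<iota> W n h" for n h u v c
    using cpair_cadd[OF f_in[OF cpure_in] f_in[OF cpure_in] h] cpair_cscale_const[OF h]
    by (simp_all flip: cadd_cpure_eq cscale_cpure_eq add: f_add f_scale cpure_in)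
  have fam: "linear_family \<iota> V W ?\<phi>"
    unfolding linear_family_def using f_in cpure_in lin by blast
  note pull = adic_form_pullback[OF fam]
  have finite: "(\<lambda>m. a +o adic \<iota> V m) \<in> ctensor \<iota> V \<and> (\<forall>n h. adic_form \<iota> W n h \<longrightarrow>
     cpair n h (f (\<lambda>m. a +o adic \<iota> V m)) = feval (\<lambda>p. cpair n (\<lambda>w s. h w (snd p * s)) (?\<phi> (fst p))) a)" for a
  proof (induction a rule: formal_combination_induct)
    case (scaled c p)
    obtain v r where p: "p = (v, r)" by (cases p)
    let ?e = "\<lambda>m. fscale c (gen p) +o adic \<iota> V m"
    have e_in: "?e \<in> ctensor \<iota> V" by (rule ctensorI) auto
    have e: "?e = cscale \<iota> V (\<iota> c * r) (cpure \<iota> V v 1)"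
    proof (rule ctensor_eqI[OF e_in cscale_in[OF cpure_in]])
      fix n h assume h: "adic_form \<iota> V n h"
      show "cpair n h ?e = cpair n h (cscale \<iota> V (\<iota> c * r) (cpure \<iota> V v 1))"
        unfolding cpair_level[of ?e n, OF refl h] cpair_cscale[OF h] cpair_cpure[OF adic_form_scale[OF h]]
        by (simp add: feval_fscale p adic_formD[OF h])
    qed
    have "cpair n h (f ?e) = c * cpair n (\<lambda>w s. h w (r * s)) (?\<phi> v)" if h: "adic_form \<iota> W n h" for n h
      unfolding e f_scale[OF cpure_in] cpair_cscale[OF h] by (simp add: mult.assoc adic_formD[OF h] cpair_fun_cmult)
    then show ?case using e_in by (simp add: feval_fscale p)
  next
    case (add a b)
    let ?e = "\<lambda>a m. a +o adic \<iota> V m"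
    have e_in: "?e (a + b) \<in> ctensor \<iota> V" by (rule ctensorI) auto
    have ab: "?e a \<in> ctensor \<iota> V" "?e b \<in> ctensor \<iota> V" using add by blast+
    have e: "?e (a + b) = cadd (?e a) (?e b)"
    proof (rule ctensor_eqI[OF e_in cadd_in[OF ab]])
      fix n h assume h: "adic_form \<iota> V n h"
      show "cpair n h (?e (a + b)) = cpair n h (cadd (?e a) (?e b))"
        unfolding cpair_cadd[OF ab h] cpair_level[of "?e _" n, OF refl h] by (rule feval_add)
    qed
    show ?case
      unfolding e f_add[OF ab] using cadd_in[OF ab] add cpair_cadd[OF f_in[OF ab(1)] f_in[OF ab(2)]]
      by (simp add: feval_add)
  qed
  have "cpair n h (f x) = cpair n (\<lambda>v r. cpair n (\<lambda>w s. h w (r * s)) (?\<phi> v)) x"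
    if h: "adic_form \<iota> W n h" and x: "x \<in> ctensor \<iota> V" for n h x
  proof -
    obtain m where m: "\<forall>x\<in>ctensor \<iota> V. \<forall>y\<in>ctensor \<iota> V. x m = y m \<longrightarrow> f x n = f y n"
      using f_cont by blast
    \<comment> \<open>The level is raised to at least \<open>n\<close>, so that the pulled back form is defined at it.\<close>
    let ?l = "max m n"
    let ?a = "rep (x ?l)"
    let ?e = "\<lambda>k. ?a +o adic \<iota> V k"
    have e_in: "?e \<in> ctensor \<iota> V" using finite[of ?a] by blast
    have "x m = ?e m"
    proof (rule ctensor_level_eqI[OF x e_in])
      fix g assume g: "adic_form \<iota> V m g"
      have "cpair m g x = cpair ?l g x"
        by (rule cpair_eq_level[OF x g adic_form_mono[OF g]]) simp
      then show "cpair m g x = cpair m g ?e"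
        unfolding cpair_level[of ?e m, OF refl g] by (simp add: cpair_def)
    qed
    then have "f x n = f ?e n" by (rule m[rule_format, OF x e_in])
    then have "cpair n h (f x) = cpair n h (f ?e)" by (simp add: cpair_def)
    also have "\<dots> = feval (\<lambda>p. cpair n (\<lambda>w s. h w (snd p * s)) (?\<phi> (fst p))) ?a"
      using finite[of ?a] h by blast
    also have "\<dots> = cpair n (\<lambda>v r. cpair n (\<lambda>w s. h w (r * s)) (?\<phi> v)) x"
      using cpair_eq_level[OF x pull[OF h] adic_form_mono[OF pull[OF h], of ?l]] by (simp add: cpair_def)
    finally show ?thesis .
  qed
  then show ?thesis
    unfolding extends_linearly_def using f_in fam by simp
qed


section \<open>Convolution and the push-forward\<close>

lemma bilin_cmul_family:
  assumes "graded_comm_algebra W" "linear_family \<iota> V W \<phi>" "linear_family \<iota> V W \<psi>" and h: "adic_form \<iota> W n h"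
  shows "bilin V (\<lambda>a b. cpair n h (cmul \<iota> W (\<phi> a) (\<psi> b)))"
proof -
  note f2 = adic_form2_mul[OF assms(1) h]
  show ?thesis
    unfolding bilin_def cpair_cmul[OF h] cpair2_def
    using linear_familyD(2,3)[OF assms(2) adic_form2_outer[OF f2]]
      linear_familyD(2,3)[OF assms(3) adic_form2_inner(1)[OF f2]]
    by (simp add: cpair_fun_add cpair_fun_cmult)
qed

text \<open>
  The restriction of \<open>f \<star> g\<close> to \<open>V\<close>, whose continuous extension is the convolution.
\<close>

definition conv_on_gen :: "('k::field_char_0 \<Rightarrow> 'r::comm_ring_1) \<Rightarrow> ('k, 'v::ab_group_add, 'r) mv_struct \<Rightarrow>
    ('k, 'w::ab_group_add, 'r) mv_struct \<Rightarrow> (('k, 'v, 'r) ctens \<Rightarrow> ('k, 'w, 'r) ctens) \<Rightarrow>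
    (('k, 'v, 'r) ctens \<Rightarrow> ('k, 'w, 'r) ctens) \<Rightarrow> 'v \<Rightarrow> ('k, 'w, 'r) ctens" where
  "conv_on_gen \<iota> V W f g v n = flin (\<lambda>xs. case xs of
         [a, b] \<Rightarrow> rep (cmul \<iota> W (f (cpure \<iota> V a 1)) (g (cpure \<iota> V b 1)) n)
       | _ \<Rightarrow> 0) (rep (comul V v)) +o adic \<iota> W n"

lemma conv_eq_cext: "conv \<iota> V W f g = cext \<iota> W (conv_on_gen \<iota> V W f g)"
  by (simp add: conv_def conv_on_gen_def[abs_def])

lemma cpair_conv_on_gen:
  assumes h: "adic_form \<iota> W n h"
  shows "cpair n h (conv_on_gen \<iota> V W f g v)
    = tpair (\<lambda>a b. cpair n h (cmul \<iota> W (f (cpure \<iota> V a 1)) (g (cpure \<iota> V b 1)))) (comul V v)"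
proof -
  have "feval (\<lambda>p. h (fst p) (snd p)) (case xs of
         [a, b] \<Rightarrow> rep (cmul \<iota> W (f (cpure \<iota> V a 1)) (g (cpure \<iota> V b 1)) n)
       | _ \<Rightarrow> 0) = on_pairs (\<lambda>a b. cpair n h (cmul \<iota> W (f (cpure \<iota> V a 1)) (g (cpure \<iota> V b 1)))) xs" for xs
    by (auto simp: on_pairs_def cpair_def split: list.splits)
  then show ?thesis
    by (simp add: cpair_level[of "conv_on_gen \<iota> V W f g v" n, OF conv_on_gen_def h] feval_flin tpair_def)
qed

lemma linear_family_conv_on_gen:
  assumes V: "graded_cocomm_coalgebra V" and W: "graded_comm_algebra W"
    and f: "linear_family \<iota> V W (\<lambda>v. f (cpure \<iota> V v 1))" and g: "linear_family \<iota> V W (\<lambda>v. g (cpure \<iota> V v 1))"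
  shows "linear_family \<iota> V W (conv_on_gen \<iota> V W f g)"
  unfolding linear_family_def
proof (intro conjI allI impI)
  let ?B = "\<lambda>n h a b. cpair n h (cmul \<iota> W (f (cpure \<iota> V a 1)) (g (cpure \<iota> V b 1)))"
  fix v
  let ?t = "\<lambda>n. flin (\<lambda>xs. case xs of
         [a, b] \<Rightarrow> rep (cmul \<iota> W (f (cpure \<iota> V a 1)) (g (cpure \<iota> V b 1)) n)
       | _ \<Rightarrow> 0) (rep (comul V v))"
  show "conv_on_gen \<iota> V W f g v \<in> ctensor \<iota> W"
  proof (rule ctensorI[of _ ?t, OF conv_on_gen_def])
    fix n h assume h: "adic_form \<iota> W n h"
    have h': "adic_form \<iota> W (Suc n) h" by (rule adic_form_mono[OF h]) simp
    have "cpair (Suc n) h (conv_on_gen \<iota> V W f g v) = cpair n h (conv_on_gen \<iota> V W f g v)"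
      unfolding cpair_conv_on_gen[OF h] cpair_conv_on_gen[OF h']
      by (simp add: cpair_Suc[OF cmul_in[OF W linear_familyD(1)[OF f] linear_familyD(1)[OF g]] h])
    then show "feval (\<lambda>p. h (fst p) (snd p)) (?t (Suc n)) = feval (\<lambda>p. h (fst p) (snd p)) (?t n)"
      by (simp only: cpair_level[of "conv_on_gen \<iota> V W f g v" "Suc n", OF conv_on_gen_def h']
          cpair_level[of "conv_on_gen \<iota> V W f g v" n, OF conv_on_gen_def h])
  qed
next
  fix n h u v c assume h: "adic_form \<iota> W n h"
  note b = bilin_cmul_family[OF W f g h]
  show "cpair n h (conv_on_gen \<iota> V W f g (u + v))
      = cpair n h (conv_on_gen \<iota> V W f g u) + cpair n h (conv_on_gen \<iota> V W f g v)"
    "cpair n h (conv_on_gen \<iota> V W f g (vscale V c v)) = c * cpair n h (conv_on_gen \<iota> V W f g v)"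
    unfolding cpair_conv_on_gen[OF h] by (rule tpair_comul_add[OF V b] tpair_comul_scale[OF V b])+
qed

lemma extends_linearly_conv:
  assumes "graded_cocomm_coalgebra V" "graded_comm_algebra W" "extends_linearly \<iota> V W f" "extends_linearly \<iota> V W g"
  shows "extends_linearly \<iota> V W (conv \<iota> V W f g)"
  unfolding conv_eq_cext
  by (rule extends_linearly_cext[OF linear_family_conv_on_gen[OF assms(1,2)
        extends_linearlyD(2)[OF assms(3)] extends_linearlyD(2)[OF assms(4)]]])

text \<open>
  Evaluate \<open>\<mu>(f \<otimes> g)\<close> on \<open>\<delta>(E) = E \<otimes> E\<close>. The fourfold sum that arises factors into \<open>f(E)\<close> and \<open>g(E)\<close> after
  the two inner summations are interchanged.
\<close>

lemma conv_grouplike: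
  assumes V: "graded_cocomm_coalgebra V" and W: "graded_comm_algebra W"
    and f: "extends_linearly \<iota> V W f" and g: "extends_linearly \<iota> V W g"
    and E: "E \<in> ctensor \<iota> V"
    and grouplike: "\<And>n b. adic_form2 \<iota> V n b \<Longrightarrow> coev V n b E = cpair2 n b E E"
  shows "conv \<iota> V W f g E = cmul \<iota> W (f E) (g E)"
proof (rule ctensor_eqI)
  show "conv \<iota> V W f g E \<in> ctensor \<iota> W"
    by (rule extends_linearlyD(1)[OF extends_linearly_conv[OF V W f g] E])
  show "cmul \<iota> W (f E) (g E) \<in> ctensor \<iota> W"
    by (intro cmul_in W extends_linearlyD(1)[OF f E] extends_linearlyD(1)[OF g E])
  fix n h assume h: "adic_form \<iota> W n h"
  let ?f = "\<lambda>v. f (cpure \<iota> V v 1)" and ?g = "\<lambda>v. g (cpure \<iota> V v 1)"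
  define b where "b u v t = cpair n (\<lambda>w s. h w (t * s)) (cmul \<iota> W (?f u) (?g v))" for u v t
  note m = adic_form2_mul[OF W h]
  have b_alt: "b u v t = cpair n (\<lambda>w s. cpair n (\<lambda>w' s'. h (mul W w w') (t * (s * s'))) (?g v)) (?f u)" for u v t
    unfolding b_def cpair_cmul[OF adic_form_scale[OF h]] cpair2_def ..
  have kill: "h w (t * s) = 0" if "t \<in> max_ideal_pow n" for w t s
    using adic_formD(5)[OF h max_ideal_pow_mult_left[OF that, of s]] by (simp add: mult.commute)
  have b: "adic_form2 \<iota> V n b"
    unfolding adic_form2_def adic_form_def b_def
    by (simp add: bilinD[OF bilin_cmul_family[OF W extends_linearlyD(2)[OF f] extends_linearlyD(2)[OF g]
            adic_form_scale[OF h]]] adic_formD(2,4)[OF h] distrib_right mult.assoc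
          cpair_fun_add cpair_fun_cmult kill)
  have "cpair n h (conv \<iota> V W f g E) = coev V n b E"
    unfolding conv_eq_cext cpair_cext[OF h] cpair_conv_on_gen[OF adic_form_scale[OF h]] coev_def b_def ..
  also have "\<dots> = cpair2 n b E E" by (rule grouplike[OF b])
  also have "\<dots> = cpair n (\<lambda>v r. cpair n (\<lambda>u t. cpair n (\<lambda>w s.
      cpair n (\<lambda>w' s'. h (mul W w w') (r * t * (s * s'))) (?g u)) (?f v)) E) E"
    by (simp add: cpair2_def b_alt)
  also have "\<dots> = cpair n (\<lambda>v r. cpair n (\<lambda>w s. cpair n (\<lambda>u t.
      cpair n (\<lambda>w' s'. h (mul W w w') (r * s * (t * s'))) (?g u)) E) (?f v)) E"
    by (subst cpair_swap) (simp add: mult_ac)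
  also have "\<dots> = cpair n (\<lambda>v r. cpair n (\<lambda>w s. cpair n (\<lambda>w' s'. h (mul W w w') (r * s * s')) (g E)) (?f v)) E"
    by (simp add: extends_linearlyD(3)[OF g adic_form2_inner(1)[OF m] E])
  also have "\<dots> = cpair n (\<lambda>w s. cpair n (\<lambda>w' s'. h (mul W w w') (s * s')) (g E)) (f E)"
    by (rule extends_linearlyD(3)[OF f adic_form2_outer[OF m] E, symmetric])
  also have "\<dots> = cpair n h (cmul \<iota> W (f E) (g E))"
    by (simp add: cpair_cmul[OF h] cpair2_def)
  finally show "cpair n h (conv \<iota> V W f g E) = cpair n h (cmul \<iota> W (f E) (g E))" .
qed

lemma extends_linearly_conv_unit:
  assumes "graded_cocomm_coalgebra V"
  shows "extends_linearly \<iota> V W (conv_unit \<iota> V W)"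
  unfolding conv_unit_def
proof (rule extends_linearly_cext)
  have "counit V (u + v) = counit V u + counit V v" "counit V (vscale V c v) = c * counit V v" for u v c
    using assms by (simp_all add: graded_cocomm_coalgebra_def Vector_Spaces.linear_iff)
  then show "linear_family \<iota> V W (\<lambda>v. cpure \<iota> W (vscale W (counit V v) (unit W)) 1)"
    by (simp add: linear_family_def cpure_in cpair_cpure adic_formD distrib_right mult.assoc)
qed

lemma extends_linearly_conv_pow:
  assumes "graded_cocomm_coalgebra V" "graded_comm_algebra W" "extends_linearly \<iota> V W f"
  shows "extends_linearly \<iota> V W (conv_pow \<iota> V W f k)"
  by (induction k) (simp_all add: assms extends_linearly_conv_unit extends_linearly_conv)


text \<open>
  Positive powers of \<open>S\<close> are killed by the multiplicative functional \<open>\<epsilon>\<close>, because \<open>\<epsilon>\<close> vanishes on primitive elements;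
  only the constant term of the exponential remains.
\<close>

lemma conv_unit_cexp:
  assumes V: "graded_comm_algebra V" "graded_cocomm_coalgebra V"
    and eps: "counit V (unit V) = 1" "\<And>a b. counit V (mul V a b) = counit V a * counit V b"
    and S: "S \<in> csub \<iota> V (primitives V)" "vanishing \<iota> V 1 S"
  shows "conv_unit \<iota> V W (cexp \<iota> V S) = cone \<iota> W"
proof (rule ctensor_eqI[OF _ cone_in])
  note S_in = csub_subset_ctensor[OF S(1)]
  have E: "series_value \<iota> V S (fps_exp 1) (cexp \<iota> V S)" by (rule series_value_exp[OF V(1) S_in S(2)])
  then have E_in: "cexp \<iota> V S \<in> ctensor \<iota> V" by (simp add: series_value_def)
  show "conv_unit \<iota> V W (cexp \<iota> V S) \<in> ctensor \<iota> W"
    by (rule extends_linearlyD(1)[OF extends_linearly_conv_unit[OF V(2)] E_in])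
  fix n h assume h: "adic_form \<iota> W n h"
  \<comment> \<open>\<open>g\<close> is the form \<open>h\<close> pulled back along \<open>\<eta>\<epsilon>\<close>.\<close>
  define g where "g v r = counit V v * h (unit W) r" for v r
  have lin: "counit V (u + v) = counit V u + counit V v" "counit V (vscale V c v) = c * counit V v" for u v c
    using V(2) by (simp_all add: graded_cocomm_coalgebra_def Vector_Spaces.linear_iff)
  have g: "adic_form \<iota> V n g"
    by (simp add: adic_form_def g_def lin adic_formD[OF h] distrib_left distrib_right mult.left_commute)
  have pow: "cpair n g (cpow \<iota> V S (Suc k)) = 0" for k
  proof -
    note o = adic_form2_outer[OF adic_form2_mul[OF V(1) g], of "cpow \<iota> V S k"]
    have "cpair n g (cpow \<iota> V S (Suc k)) = cpair n (\<lambda>v r. 0) S"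
      unfolding cpow.simps cpair_cmul[OF g] cpair2_def
      by (rule cpair_csub_cong[OF S(1) o])
         (simp_all add: adic_form_def g_def eps counit_primitive[OF V(2) eps(1)])
    then show ?thesis by simp
  qed
  have "cpair n h (conv_unit \<iota> V W (cexp \<iota> V S)) = cpair n g (cexp \<iota> V S)"
    unfolding conv_unit_def cpair_cext[OF h] cpair_cpure[OF adic_form_scale[OF h]]
    by (simp add: adic_formD[OF h] g_def[abs_def])
  also have "\<dots> = (\<Sum>k<n. 1 / fact k * cpair n g (cpow \<iota> V S k))"
    using E g by (simp add: series_value_def)
  also have "\<dots> = cpair n h (cone \<iota> W)"
  proof (cases n)
    case 0
    then show ?thesis using h vanishing_0[of \<iota> W "cone \<iota> W"] by (simp add: vanishing_def)
  next
    case (Suc m)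
    have "(\<Sum>k<n. 1 / fact k * cpair n g (cpow \<iota> V S k)) = cpair n g (cone \<iota> V)"
      unfolding Suc sum.lessThan_Suc_shift using pow by (simp add: Suc del: cpow.simps(2))
    then show ?thesis by (simp add: cpair_cone[OF h] cpair_cone[OF g] g_def eps)
  qed
  finally show "cpair n h (conv_unit \<iota> V W (cexp \<iota> V S)) = cpair n h (cone \<iota> W)" .
qed

lemma conv_pow_cexp:
  assumes V: "graded_comm_algebra V" "graded_cocomm_coalgebra V" "bialgebra_compatible V"
    and one: "comul V (unit V) = gen [unit V, unit V] +o multilin_rel V"
    and eps: "counit V (unit V) = 1" "\<And>a b. counit V (mul V a b) = counit V a * counit V b"
    and S: "S \<in> csub \<iota> V (primitives V)" "S \<in> csub \<iota> V (grading V 0)" "vanishing \<iota> V 1 S"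
    and W: "graded_comm_algebra W" and f: "extends_linearly \<iota> V W f"
  shows "conv_pow \<iota> V W f k (cexp \<iota> V S) = cpow \<iota> W (f (cexp \<iota> V S)) k"
proof (induction k)
  case 0
  then show ?case by (simp add: conv_unit_cexp[OF V(1,2) eps S(1,3)])
next
  case (Suc k)
  then show ?case
    using conv_grouplike[OF V(2) W f extends_linearly_conv_pow[OF V(2) W f] cexp_in[OF V one S]
        cexp_grouplike[OF V one S]] by simp
qed

text \<open>
  At level \<open>1\<close> a form satisfies \<open>h(v, r) = h(r\<^sub>0 v, 1)\<close>, where \<open>r\<^sub>0\<close> is the residue of \<open>r\<close>. So its value
  on \<open>x\<close> depends only on the reduction of \<open>x\<close> in \<open>V\<close>.
\<close>

lemma vanishing_of_reduction:
  fixes x :: "('k::field, 'v::ab_group_add, 'r::comm_ring_1) ctens"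
  assumes alg: "complete_local_noetherian_algebra \<iota>" and V: "vector_space (vscale V)"
    and x: "x \<in> ctensor_m \<iota> V"
  shows "vanishing \<iota> V 1 x"
  unfolding vanishing_def
proof (intro allI impI)
  interpret vs: vector_space "vscale V" by (rule V)
  fix h assume h: "adic_form \<iota> V 1 h"
  have res: "h v r = residue \<iota> r * h v 1" for v r
  proof -
    have "\<exists>!c. r - \<iota> c \<in> max_ideal" using alg by (simp add: complete_local_noetherian_algebra_def)
    then have "r - \<iota> (residue \<iota> r) \<in> max_ideal"
      unfolding residue_def by (rule theI')
    then have "h v (r - \<iota> (residue \<iota> r) * 1) = 0"
      unfolding mult_1_right by (rule adic_formD(5)[OF h subsetD[OF max_ideal_subset_pow_1]])
    moreover have "h v r = h v (r - \<iota> (residue \<iota> r) * 1) + h v (\<iota> (residue \<iota> r) * 1)"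
      by (simp only: adic_formD(2)[OF h, symmetric] diff_add_cancel)
    ultimately show ?thesis using adic_formD(4)[OF h, of v "residue \<iota> r" 1] by simp
  qed
  have h_sum: "(\<Sum>p\<in>A. h (u p) 1) = h (\<Sum>p\<in>A. u p) 1" for A :: "('v \<times> 'r) set" and u
    by (induction A rule: infinite_finite_induct) (simp_all add: adic_form_zero[OF h] adic_formD(1)[OF h])
  have "cpair 1 h x = (\<Sum>p\<in>Poly_Mapping.keys (rep (x 1)).
      Poly_Mapping.lookup (rep (x 1)) p * (residue \<iota> (snd p) * h (fst p) 1))"
    unfolding cpair_def feval_def by (intro sum.cong refl arg_cong2[of _ _ _ _ "(*)"] res)
  also have "\<dots> = (\<Sum>p\<in>Poly_Mapping.keys (rep (x 1)).
      h (vscale V (Poly_Mapping.lookup (rep (x 1)) p * residue \<iota> (snd p)) (fst p)) 1)"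
    by (simp add: adic_formD(3)[OF h] mult.assoc)
  also have "\<dots> = h (\<Sum>p\<in>Poly_Mapping.keys (rep (x 1)).
      vscale V (Poly_Mapping.lookup (rep (x 1)) p * residue \<iota> (snd p)) (fst p)) 1"
    by (rule h_sum)
  also have "\<dots> = h (reduction \<iota> V x) 1"
    by (simp add: reduction_def case_prod_beta)
  also have "\<dots> = 0"
    using x adic_form_zero(1)[OF h] by (simp add: ctensor_m_def csub_m_def)
  finally show "cpair 1 h x = 0" .
qed

theorem theorem44:
  fixes \<iota> :: "'k::field_char_0 \<Rightarrow> 'r::comm_ring_1"
    and V' :: "('k, 'v::ab_group_add, 'r) mv_struct"
    and V'' :: "('k, 'w::ab_group_add, 'r) mv_struct"
    and f :: "('k, 'v, 'r) ctens \<Rightarrow> ('k, 'w, 'r) ctens"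
    and S :: "('k, 'v, 'r) ctens"
  assumes "complete_local_noetherian_algebra \<iota>"
    and "MV_algebra \<iota> V'"
    and "MV_algebra \<iota> V''"
    and "f \<in> MV_morphisms \<iota> V' V''"
    and "S \<in> QME \<iota> V'"
    and "bialgebra_compatible V'"
    and "S \<in> csub_m \<iota> V' (primitives V')"
  shows "push_forward \<iota> V' V'' f S = f (cexp \<iota> V' S)"
proof -
  have V: "graded_comm_algebra V'" "graded_cocomm_coalgebra V'"
    and one: "comul V' (unit V') = gen [unit V', unit V'] +o multilin_rel V'"
    and eps: "counit V' (unit V') = 1" "\<And>a b. counit V' (mul V' a b) = counit V' a * counit V' b"
    using assms(2) by (simp_all add: MV_algebra_def)
  have W: "graded_comm_algebra V''" using assms(3) by (simp add: MV_algebra_def)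
  have vs: "vector_space (vscale V')" "vector_space (vscale V'')"
    using V(1) W by (simp_all add: graded_comm_algebra_def graded_space_def)
  have S: "S \<in> csub \<iota> V' (primitives V')" "S \<in> csub \<iota> V' (grading V' 0)"
    using assms(5,7) by (simp_all add: QME_def csub_m_def)
  have "S \<in> ctensor_m \<iota> V'"
    using assms(7) csub_subset_ctensor[OF S(1)] by (simp add: ctensor_m_def csub_m_def ctensor_def)
  then have S1: "vanishing \<iota> V' 1 S" by (rule vanishing_of_reduction[OF assms(1) vs(1)])
  have f: "extends_linearly \<iota> V' V'' f"
    using assms(4) by (intro extends_linearly_cont_lin[of f \<iota> V' V'' 0]) (simp add: MV_morphisms_def Lin0_def Lin_def)
  let ?E = "cexp \<iota> V' S"
  have E: "series_value \<iota> V' S (fps_exp 1) ?E"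
    by (rule series_value_exp[OF V(1) csub_subset_ctensor[OF S(1)] S1])
  then have E_in: "?E \<in> ctensor \<iota> V'" by (simp add: series_value_def)
  have "conv_exp \<iota> V' V'' f ?E = cexp \<iota> V'' (f ?E)"
    by (simp add: conv_exp_def cexp_def[of \<iota> V'' "f ?E"] conv_pow_cexp[OF V assms(6) one eps S S1 W f])
  moreover have "vanishing \<iota> V'' 1 (f ?E)"
    unfolding vanishing_def
  proof (intro allI impI)
    fix h assume h: "adic_form \<iota> V'' 1 h"
    let ?h = "\<lambda>v r. cpair 1 (\<lambda>w s. h w (r * s)) (f (cpure \<iota> V' v 1))"
    have h': "adic_form \<iota> V' 1 ?h" by (rule adic_form_pullback[OF extends_linearlyD(2)[OF f] h])
    \<comment> \<open>At level \<open>1\<close> the exponential is the unit, and \<open>f\<close> sends the unit into the kernel of the reduction.\<close>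
    have "f (cpure \<iota> V' (vscale V' 1 (unit V')) 1) \<in> ctensor_m \<iota> V''"
      using assms(4) unfolding MV_morphisms_def Lin0_def by blast
    then have "f (cone \<iota> V') \<in> ctensor_m \<iota> V''"
      using vs(1) by (simp add: cone_def vector_space.vector_space_assms(4))
    then have "cpair 1 h (f (cone \<iota> V')) = 0"
      using vanishing_of_reduction[OF assms(1) vs(2)] h by (simp add: vanishing_def)
    then have "cpair 1 ?h (cone \<iota> V') = 0"
      by (simp only: extends_linearlyD(3)[OF f h cone_in])
    then show "cpair 1 h (f ?E) = 0"
      unfolding extends_linearlyD(3)[OF f h E_in] using E h' by (simp add: series_value_def)
  qed
  ultimately show ?thesis
    unfolding push_forward_def using clog_cexp[OF W extends_linearlyD(1)[OF f E_in]] by simp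
qed

end
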